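(* Let $m\ge 3$ be an integer. Then every integer $N\ge 924m^3$ can be written as $p_{m+2}(x_1)+p_{m+2}(x_2)+p_{m+2}(x_3)+3p_{m+2}(x_4)$ with $x_1,x_2,x_3,x_4\in\mathbb{N}$.
   Context: $\mathbb{N}=\{0,1,2,\dots\}$. For integers $m\ge1$ and $n$, $p_{m+2}(n)=m\binom n2+n=\frac{mn^2-(m-2)n}{2}$. *)

theory Defs
  imports Main
begin

text \<open>
  \<open>polygonal s n\<close> is \<open>p\<^bsub>s\<^esub>(n)\<close>, the number of sides \<open>s\<close> being the subscript itself (so
  \<open>p\<^bsub>m+2\<^esub>(n)\<close> is \<open>polygonal (m + 2) n\<close>), for every integer \<open>n\<close>. The quotient
  \<open>n * (n - 1) div 2\<close> is exact; it is the binomial coefficient \<open>n\<close> over 2, which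
  for integers cannot be written with \<open>gchoose\<close>, because of the sort constraint on that constant.
\<close>

definition polygonal :: "int \<Rightarrow> int \<Rightarrow> int" where
  "polygonal s n = (s - 2) * (n * (n - 1) div 2) + n"

lemma polygonal_of_nat:
  "polygonal (m + 2) (int n) = m * int (n choose 2) + int n"
proof -
  have "int n * (int n - 1) = int (n * (n - 1))"
    by (cases n) (simp_all add: algebra_simps)
  then have "int n * (int n - 1) div 2 = int (n choose 2)"
    by (simp only: choose_two zdiv_int of_nat_numeral)
  then show ?thesis
    by (simp add: polygonal_def)
qed

lemma two_times_polygonal:
  "2 * polygonal (m + 2) n = m * n\<^sup>2 - (m - 2) * n"
proof -
  have "2 * (n * (n - 1) div 2) = n * (n - 1)"
    by simp
  then have "2 * polygonal (m + 2) n = m * (n * (n - 1)) + 2 * n"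
    unfolding polygonal_def by (simp add: distrib_left mult.left_commute)
  then show ?thesis
    by (simp add: algebra_simps power2_eq_square)
qed

lemma polygonal_closed_form:
  "polygonal (m + 2) n = (m * n\<^sup>2 - (m - 2) * n) div 2"
  using two_times_polygonal[of m n] by simp

end

theory Submission
  imports Defs "HOL-Analysis.Infinite_Sum" "HOL-Analysis.Derivative"
    "HOL-Computational_Algebra.Polynomial" "HOL-Number_Theory.Number_Theory"
    "HOL-Computational_Algebra.Squarefree"
begin

text \<open>
  Write \<open>N = m q + r\<close> with \<open>0 \<le> r < m\<close>. With \<open>a = x\<^sub>1\<^sup>2 + x\<^sub>2\<^sup>2 + x\<^sub>3\<^sup>2 + 3 x\<^sub>4\<^sup>2\<close> and
  \<open>b = x\<^sub>1 + x\<^sub>2 + x\<^sub>3 + 3 x\<^sub>4\<close> the equation becomes \<open>b = r + m i\<close>, \<open>a = b + 2 (q - i)\<close> for some \<open>i\<close>.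
  As in Cauchy's proof of the polygonal number theorem, such \<open>x\<^sub>j \<ge> 0\<close> exist once \<open>b\<^sup>2 < 6 a\<close>,
  \<open>5 a < b\<^sup>2 + 2 b + 6\<close> and \<open>6 a - b\<^sup>2 = t\<^sup>2 + s\<^sup>2 + 3 v\<^sup>2\<close> with suitable parities. The size conditions
  leave a window of six consecutive \<open>i\<close>, in which one can prescribe the residue of \<open>6 a - b\<^sup>2\<close>.

  To represent a suitable odd squarefree \<open>n\<close> (or \<open>3 n\<close>) by \<open>t\<^sup>2 + s\<^sup>2 + 3 v\<^sup>2\<close>, one builds an integral
  ternary form of determinant 3 representing it out of a modulus \<open>k\<close> with prescribed Legendre
  symbols \<open>(k/p)\<close>, \<open>p\<close> dividing \<open>n\<close>, modulo which \<open>- D\<close> is a square (\<open>D = 3 n\<close> or \<open>D = n\<close>); only two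
  classes of such forms exist. Dirichlet's theorem on primes is not needed to find \<open>k\<close>: if
  \<open>\<chi>\<close> is the character of \<open>- D\<close> and \<open>r(k) = \<Sum>\<^bsub>d dvd k\<^esub> \<chi>(d) \<ge> 0\<close>, then for each genus character
  \<open>\<psi> \<noteq> 1, \<chi>\<close> the series \<open>\<Sum>\<^bsub>k\<^esub> \<psi>(k) r(k) x\<^sup>k\<close> stays bounded as \<open>x\<close> tends to 1, while
  \<open>\<Sum>\<^bsub>k\<^esub> r(k) x\<^sup>k\<close> diverges because of the squares; so some \<open>k\<close> with the prescribed
  character values has \<open>r(k) > 0\<close>.
\<close>

section \<open>Ternary forms of determinant 3\<close>

text \<open>The Gram matrix has diagonal \<open>a\<close>, \<open>b\<close>, \<open>c\<close> and
  off-diagonal entries \<open>d\<close> for \<open>y z\<close>, \<open>e\<close> for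
  \<open>x z\<close>, \<open>f\<close> for \<open>x y\<close>. Cross coefficients are even, so this
  matrix is integral; \<open>tern_det\<close> is its determinant.\<close>

definition tern :: "int \<Rightarrow> int \<Rightarrow> int \<Rightarrow> int \<Rightarrow> int \<Rightarrow> int \<Rightarrow> int \<Rightarrow> int \<Rightarrow> int \<Rightarrow> int" where
  "tern a b c d e f x y z = a*x\<^sup>2 + b*y\<^sup>2 + c*z\<^sup>2 + 2*d*y*z + 2*e*x*z + 2*f*x*y"

text \<open>Equivalence of forms is tracked only through the set of represented values, which is all
  that the final representation requires.\<close>

definition tern_vals :: "int \<Rightarrow> int \<Rightarrow> int \<Rightarrow> int \<Rightarrow> int \<Rightarrow> int \<Rightarrow> int set" where
  "tern_vals a b c d e f = {tern a b c d e f x y z | x y z. True}"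

definition tern_det :: "int \<Rightarrow> int \<Rightarrow> int \<Rightarrow> int \<Rightarrow> int \<Rightarrow> int \<Rightarrow> int" where
  "tern_det a b c d e f = a*b*c + 2*d*e*f - a*d\<^sup>2 - b*e\<^sup>2 - c*f\<^sup>2"

lemma tern_in_vals [simp]: "tern a b c d e f x y z \<in> tern_vals a b c d e f"
  by (auto simp: tern_vals_def)

lemma tern_vals_eqI:
  assumes "\<And>x y z. tern a b c d e f x y z \<in> tern_vals a' b' c' d' e' f'"
    and "\<And>x y z. tern a' b' c' d' e' f' x y z \<in> tern_vals a b c d e f"
  shows "tern_vals a b c d e f = tern_vals a' b' c' d' e' f'"
  using assms unfolding tern_vals_def by blast

text \<open>The substitution \<open>x := x + t y\<close> is undone by \<open>x := x - t y\<close>.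
  The other shifts follow by conjugation with coordinate swaps.\<close>

lemma tern_vals_shift_xy:
  "tern_vals a (b + 2*t*f + t\<^sup>2*a) c (d + t*e) e (f + t*a) = tern_vals a b c d e f"
proof (rule tern_vals_eqI)
  fix x y z
  have "tern a (b + 2*t*f + t\<^sup>2*a) c (d + t*e) e (f + t*a) x y z = tern a b c d e f (x + t*y) y z"
    by (simp add: tern_def power2_eq_square algebra_simps)
  then show "tern a (b + 2*t*f + t\<^sup>2*a) c (d + t*e) e (f + t*a) x y z \<in> tern_vals a b c d e f"
    by simp
  have "tern a b c d e f x y z = tern a (b + 2*t*f + t\<^sup>2*a) c (d + t*e) e (f + t*a) (x - t*y) y z"
    by (simp add: tern_def power2_eq_square algebra_simps)
  then show "tern a b c d e f x y z \<in> tern_vals a (b + 2*t*f + t\<^sup>2*a) c (d + t*e) e (f + t*a)"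
    by simp
qed

lemma tern_vals_swap_xy: "tern_vals b a c e d f = tern_vals a b c d e f"
proof (rule tern_vals_eqI)
  fix x y z
  have "tern b a c e d f x y z = tern a b c d e f y x z" for a b c d e f x y
    by (simp add: tern_def algebra_simps)
  then show "tern b a c e d f x y z \<in> tern_vals a b c d e f"
    "tern a b c d e f x y z \<in> tern_vals b a c e d f" by (metis tern_in_vals)+
qed

lemma tern_vals_swap_yz: "tern_vals a c b d f e = tern_vals a b c d e f"
proof (rule tern_vals_eqI)
  fix x y z
  have "tern a c b d f e x y z = tern a b c d e f x z y" for a b c d e f y z
    by (simp add: tern_def algebra_simps)
  then show "tern a c b d f e x y z \<in> tern_vals a b c d e f"
    "tern a b c d e f x y z \<in> tern_vals a c b d f e" by (metis tern_in_vals)+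
qed

lemma tern_vals_shift_xz:
  "tern_vals a b (c + 2*t*e + t\<^sup>2*a) (d + t*f) (e + t*a) f = tern_vals a b c d e f"
  using tern_vals_shift_xy[of a c t e b d f] by (simp only: tern_vals_swap_yz)

lemma tern_vals_shift_yz:
  "tern_vals a b (c + 2*t*d + t\<^sup>2*b) (d + t*b) (e + t*f) f = tern_vals a b c d e f"
  using tern_vals_shift_xz[of b a c t d e f] by (simp only: tern_vals_swap_xy)

lemma tern_vals_neg_y: "tern_vals a b c (-d) e (-f) = tern_vals a b c d e f"
proof (rule tern_vals_eqI)
  fix x y z
  have "tern a b c (-d) e (-f) x y z = tern a b c d e f x (-y) z" for d f y
    by (simp add: tern_def algebra_simps)
  from this[of d f y] this[of "-d" "-f" y]
  show "tern a b c (-d) e (-f) x y z \<in> tern_vals a b c d e f"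
    "tern a b c d e f x y z \<in> tern_vals a b c (-d) e (-f)"
    by simp_all
qed

lemma ex_shift_abs_le:
  fixes a f :: int
  assumes "a > 0"
  shows "\<exists>t. 2 * \<bar>f + t * a\<bar> \<le> a"
proof -
  \<comment> \<open>\<open>q\<close> is the floor of \<open>f / a + 1 / 2\<close>, an integer
    nearest to \<open>f / a\<close>.\<close>
  define q r t where "q = (2*f + a) div (2*a)" and "r = (2*f + a) mod (2*a)" and "t = - q"
  define p where "p = a * q"
  have "2*f + a = 2*p + r" unfolding p_def q_def r_def by (metis mult.assoc mult_div_mod_eq)
  moreover have "0 \<le> r" "r < 2*a" using assms by (auto simp: r_def)
  ultimately have "2 * \<bar>f - p\<bar> \<le> a" by presburger
  then have "2 * \<bar>f + t * a\<bar> \<le> a" by (simp add: t_def p_def mult.commute)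
  then show ?thesis ..
qed

section \<open>Reduction of positive forms of determinant 3\<close>

text \<open>Positive definiteness by Sylvester's criterion, the third leading minor being the
  determinant 3. The value set \<open>V\<close> is a parameter so that it can be carried unchanged
  through the reduction.\<close>

definition pos_form3 :: "int set \<Rightarrow> int \<Rightarrow> int \<Rightarrow> int \<Rightarrow> int \<Rightarrow> int \<Rightarrow> int \<Rightarrow> bool" where
  "pos_form3 V a b c d e f \<longleftrightarrow> a > 0 \<and> a*b - f\<^sup>2 > 0 \<and> tern_det a b c d e f = 3
     \<and> tern_vals a b c d e f = V"

text \<open>Jacobi's identity for minors. It transfers positivity from one binary minor to another
  and bounds them in the reduction.\<close>

lemma pos_form3_minor_identity:
  "(a*b - f\<^sup>2) * (a*c - e\<^sup>2) - (a*d - e*f)\<^sup>2 = a * tern_det a b c d e f"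
  by (simp add: tern_det_def power2_eq_square algebra_simps)

lemma pos_form3_swap_xy: "pos_form3 V a b c d e f \<Longrightarrow> pos_form3 V b a c e d f"
proof -
  assume h: "pos_form3 V a b c d e f"
  then have "a * b > 0" by (smt (verit) pos_form3_def zero_le_power2)
  moreover have "a > 0" using h by (simp add: pos_form3_def)
  ultimately have "b > 0" by (simp add: zero_less_mult_iff)
  then show ?thesis using h
    by (auto simp: pos_form3_def tern_vals_swap_xy tern_det_def algebra_simps)
qed

lemma pos_form3_minor_pos:
  assumes "pos_form3 V a b c d e f" shows "a*c - e\<^sup>2 > 0"
proof -
  have "(a*b - f\<^sup>2) * (a*c - e\<^sup>2) = (a*d - e*f)\<^sup>2 + a * 3"
    using pos_form3_minor_identity[of a b f c e d] assms by (simp add: pos_form3_def)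
  also have "\<dots> > 0" using assms by (smt (verit) pos_form3_def zero_le_power2)
  finally show ?thesis using assms by (simp add: pos_form3_def zero_less_mult_iff)
qed

lemma pos_form3_swap_yz:
  assumes "pos_form3 V a b c d e f" shows "pos_form3 V a c b d f e"
  using assms pos_form3_minor_pos[OF assms]
  by (auto simp: pos_form3_def tern_vals_swap_yz tern_det_def algebra_simps)

lemma pos_form3_shift_xy:
  "pos_form3 V a b c d e f \<Longrightarrow> pos_form3 V a (b + 2*t*f + t\<^sup>2*a) c (d + t*e) e (f + t*a)"
  unfolding pos_form3_def tern_vals_shift_xy
  by (auto simp: tern_det_def power2_eq_square algebra_simps)

lemma pos_form3_shift_xz:
  "pos_form3 V a b c d e f \<Longrightarrow> pos_form3 V a b (c + 2*t*e + t\<^sup>2*a) (d + t*f) (e + t*a) f"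
  unfolding pos_form3_def tern_vals_shift_xz
  by (auto simp: tern_det_def power2_eq_square algebra_simps)

lemma pos_form3_shift_yz:
  "pos_form3 V a b c d e f \<Longrightarrow> pos_form3 V a b (c + 2*t*d + t\<^sup>2*b) (d + t*b) (e + t*f) f"
  unfolding pos_form3_def tern_vals_shift_yz
  by (auto simp: tern_det_def power2_eq_square algebra_simps)

text \<open>Hermite reduction: lexicographic minimality of the first two minors forces the first
  minor to be 1.\<close>

lemma pos_form3_reduced:
  assumes "pos_form3 V a0 b0 c0 d0 e0 f0"
  shows "V = tern_vals 1 1 3 0 0 0 \<or> V = tern_vals 1 2 2 1 0 0"
proof -
  define P where "P = (\<lambda>a. \<exists>b c d e f. pos_form3 V (int a) b c d e f)"
  have "int (nat a0) = a0" using assms by (simp add: pos_form3_def)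
  then have "P (nat a0)" using assms unfolding P_def by metis
  then obtain A where A: "P A" "\<And>A'. P A' \<Longrightarrow> A \<le> A'"
    using ex_has_least_nat[of P _ "\<lambda>x. x"] by blast
  define a where "a = int A"
  have amin: "a \<le> a'" if "pos_form3 V a' b c d e f" for a' b c d e f
  proof -
    have "int (nat a') = a'" using that by (simp add: pos_form3_def)
    then have "P (nat a')" using that unfolding P_def by metis
    then show ?thesis using A(2) that by (fastforce simp: a_def pos_form3_def)
  qed
  define Q where "Q = (\<lambda>h. \<exists>b c d e f. pos_form3 V a b c d e f \<and> int h = a*b - f\<^sup>2)"
  obtain b1 c1 d1 e1 f1 where "pos_form3 V a b1 c1 d1 e1 f1" using A(1) by (auto simp: P_def a_def)
  then have "Q (nat (a*b1 - f1\<^sup>2))" unfolding Q_def pos_form3_def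
    by (metis nat_0_le order_less_imp_le)
  then obtain H where H: "Q H" "\<And>H'. Q H' \<Longrightarrow> H \<le> H'"
    using ex_has_least_nat[of Q _ "\<lambda>x. x"] by blast
  define h where "h = int H"
  have hmin: "h \<le> a*b - f\<^sup>2" if "pos_form3 V a b c d e f" for b c d e f
  proof -
    have "Q (nat (a*b - f\<^sup>2))" using that unfolding Q_def pos_form3_def
      by (metis nat_0_le order_less_imp_le)
    then show ?thesis using H(2) that by (fastforce simp: h_def pos_form3_def)
  qed
  obtain b1 c1 d1 e1 f1 where 1: "pos_form3 V a b1 c1 d1 e1 f1" "h = a*b1 - f1\<^sup>2"
    using H(1) by (auto simp: Q_def h_def)
  have a0: "a > 0" and h0: "h > 0" using 1 by (auto simp: pos_form3_def)
  obtain t1 where t1: "2 * \<bar>f1 + t1 * a\<bar> \<le> a" using ex_shift_abs_le[OF a0] by blast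
  define b f d2 where "b = b1 + 2*t1*f1 + t1\<^sup>2*a" and "f = f1 + t1*a" and "d2 = d1 + t1*e1"
  have 2: "pos_form3 V a b c1 d2 e1 f" "h = a*b - f\<^sup>2" "2*\<bar>f\<bar> \<le> a"
    using pos_form3_shift_xy[OF 1(1), of t1] 1(2) t1
    by (auto simp: b_def f_def d2_def power2_eq_square algebra_simps)
  \<comment> \<open>Shifting \<open>y\<close> by \<open>t2 z\<close> adds \<open>t2 * h\<close> to
    \<open>a*d - e*f\<close>, which can thus be reduced modulo \<open>h\<close>; the later shift of
    \<open>x\<close> by a multiple of \<open>z\<close> leaves it unchanged.\<close>
  obtain t2 where t2: "2 * \<bar>(a*d2 - e1*f) + t2 * h\<bar> \<le> h" using ex_shift_abs_le[OF h0] by blast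
  define c3 d3 e3 where "c3 = c1 + 2*t2*d2 + t2\<^sup>2*b" and "d3 = d2 + t2*b" and "e3 = e1 + t2*f"
  have 3: "pos_form3 V a b c3 d3 e3 f"
    using pos_form3_shift_yz[OF 2(1), of t2] by (simp add: c3_def d3_def e3_def)
  have g3: "a*d3 - e3*f = (a*d2 - e1*f) + t2*h"
    unfolding 2(2) d3_def e3_def by (simp add: power2_eq_square algebra_simps)
  obtain t3 where t3: "2 * \<bar>e3 + t3 * a\<bar> \<le> a" using ex_shift_abs_le[OF a0] by blast
  define c d e where "c = c3 + 2*t3*e3 + t3\<^sup>2*a" and "d = d3 + t3*f" and "e = e3 + t3*a"
  have 4: "pos_form3 V a b c d e f"
    using pos_form3_shift_xz[OF 3, of t3] by (simp add: c_def d_def e_def)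
  have e_le: "2*\<bar>e\<bar> \<le> a" using t3 by (simp add: e_def)
  define g i where "g = a*d - e*f" and "i = a*c - e\<^sup>2"
  have "g = a*d3 - e3*f" unfolding g_def d_def e_def by (simp add: algebra_simps)
  then have g_le: "2*\<bar>g\<bar> \<le> h" using g3 t2 by simp
  \<comment> \<open>With \<open>h \<le> i\<close> and \<open>2 |g| \<le> h\<close> this gives
    \<open>h^2 \<le> h i = g^2 + 3 a \<le> h^2 / 4 + 3 a\<close>, that is
    \<open>h^2 \<le> 4 a\<close>.\<close>
  have hi: "h * i = g\<^sup>2 + 3*a"
    using pos_form3_minor_identity[of a b f c e d] 4 2(2) by (simp add: pos_form3_def g_def i_def)
  have "h \<le> i" using hmin[OF pos_form3_swap_yz[OF 4]] by (simp add: i_def)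
  then have "h*h \<le> h * i" using h0 by simp
  moreover have "(2*\<bar>g\<bar>)\<^sup>2 \<le> h\<^sup>2" by (intro power_mono g_le) auto
  ultimately have hh: "h*h \<le> 4*a" using hi by (simp add: power2_eq_square)
  \<comment> \<open>Minimality of \<open>a\<close> against the swapped form. Hence
    \<open>h = a b - f^2 \<ge> a^2 - a^2 / 4\<close>, which for \<open>a \<ge> 2\<close> is
    incompatible with \<open>h^2 \<le> 4 a\<close>.\<close>
  have "a \<le> b" using amin[OF pos_form3_swap_xy[OF 4]] .
  then have "a*a \<le> a*b" using a0 by simp
  moreover have "(2*\<bar>f\<bar>)\<^sup>2 \<le> a\<^sup>2" by (intro power_mono 2(3)) auto
  ultimately have ha: "4*h \<ge> 3*(a*a)" using 2(2) by (simp add: power2_eq_square)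
  have a1: "a = 1"
  proof (rule ccontr)
    assume "a \<noteq> 1"
    then have "a \<ge> 2" using a0 by simp
    then have "a * a \<ge> 2 * a" by simp
    then have "2*h \<ge> 3*a" using ha by linarith
    then have "(2*h)*(2*h) \<ge> (3*a)*(3*a)" 
      using mult_mono[of "3*a" "2*h" "3*a" "2*h"] a0 h0 by linarith
    moreover have "(3*a)*(3*a) \<ge> 18 * a" using \<open>a * a \<ge> 2 * a\<close> by linarith
    ultimately have "4*(h*h) \<ge> 18*a" by simp
    then show False using hh a0 by linarith
  qed
  have "f = 0" "e = 0" using 2(3) e_le a1 by auto
  have gd: "g = d" "i = c" "h = b" using 2(2) by (simp_all add: g_def i_def a1 \<open>f = 0\<close> \<open>e = 0\<close>)
  have "h \<le> 2"
  proof (rule ccontr)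
    assume "\<not> h \<le> 2"
    then have "h*h \<ge> 3*3" by (intro mult_mono) auto
    then show False using hh a1 by simp
  qed
  then consider "b = 1" | "b = 2" using h0 gd by linarith
  then show ?thesis
  proof cases
    case 1
    then have "d = 0" using g_le gd by auto
    then have "c = 3" using hi gd 1 a1 by simp
    then show ?thesis using 4 1 \<open>d = 0\<close> a1 \<open>e = 0\<close> \<open>f = 0\<close> by (simp add: pos_form3_def)
  next
    case 2
    \<comment> \<open>Parity excludes \<open>d = 0\<close>, and the sign of \<open>d\<close> is
      absorbed by \<open>y := - y\<close>.\<close>
    have "d = -1 \<or> d = 0 \<or> d = 1" using g_le gd 2 by auto
    moreover have "2 * c = d\<^sup>2 + 3" using hi gd 2 a1 by simp
    moreover have "2 * c \<noteq> 3" by presburger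
    ultimately consider "d = 1" "c = 2" | "d = -1" "c = 2" by force
    then show ?thesis
    proof cases
      case 1
      then show ?thesis using 4 2 a1 \<open>e = 0\<close> \<open>f = 0\<close> by (simp add: pos_form3_def)
    next
      case b: 2
      then show ?thesis using 4 2 a1 \<open>e = 0\<close> \<open>f = 0\<close> tern_vals_neg_y[of 1 2 2 1 0 0]
        by (simp add: pos_form3_def)
    qed
  qed
qed

section \<open>Representation by the form of determinant 3\<close>

text \<open>Squares are 0 or 1 modulo 3, so \<open>x^2 + y^2\<close> is anisotropic at 3; this is
  what separates the two reduced forms.\<close>

lemma three_dvd_sum_squares:
  fixes x y :: int
  assumes "3 dvd x\<^sup>2 + y\<^sup>2"
  shows "3 dvd x" "3 dvd y"
proof -
  have sq: "3 dvd z \<and> 3 dvd z\<^sup>2 \<or> \<not> 3 dvd z \<and> 3 dvd z\<^sup>2 - 1" for z :: int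
  proof -
    have "z mod 3 = 0 \<or> z mod 3 = 1 \<or> z mod 3 = 2" by presburger
    then consider "z mod 3 = 0" | "z mod 3 = 1" | "z mod 3 = 2" by blast
    then show ?thesis
    proof cases
      case 1
      then have "3 dvd z" by presburger
      then show ?thesis by (simp add: power2_eq_square)
    next
      case 2
      then have "3 dvd z - 1" "\<not> 3 dvd z" by presburger+
      moreover have "z\<^sup>2 - 1 = (z - 1) * (z + 1)" by (simp add: power2_eq_square algebra_simps)
      ultimately show ?thesis by simp
    next
      case 3
      then have "3 dvd z + 1" "\<not> 3 dvd z" by presburger+
      moreover have "z\<^sup>2 - 1 = (z - 1) * (z + 1)" by (simp add: power2_eq_square algebra_simps)
      ultimately show ?thesis by simp
    qed
  qed
  have "3 dvd x \<and> 3 dvd y" using sq[of x] sq[of y] assms by presburger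
  then show "3 dvd x" "3 dvd y" by auto
qed

lemma three_sum_two_squares_nonzero:
  fixes z :: int
  shows "\<not> 3 dvd z\<^sup>2 + 1"
  using three_dvd_sum_squares[of z 1] by auto

text \<open>The form is \<open>(\<lambda> (n x + e y + f z)\<^sup>2 + k y\<^sup>2 + 2 B y z + l z\<^sup>2) / n\<close>; it has
  determinant 3, is anisotropic at 3, and takes the value \<open>\<lambda> n\<close> at \<open>(1, 0, 0)\<close>.\<close>

lemma represented_by_1_1_3:
  fixes n k l B D e lam :: int
  assumes n: "n > 0" and k: "k > 0" and kl: "k*l - B\<^sup>2 = D" and D: "lam * D = 3 * n"
    and cop: "coprime k n" and e: "n dvd lam * e\<^sup>2 + k"
    and cases: "lam = 1 \<and> k mod 3 = 1 \<and> \<not> 3 dvd n \<or> lam = 3 \<and> n mod 3 = 1"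
  shows "\<exists>x y z. lam * n = x\<^sup>2 + y\<^sup>2 + 3 * z\<^sup>2"
proof -
  have nD: "n dvd D" using D cases by auto
  obtain k' where "[k * k' = 1] (mod n)" using cong_solve_coprime_int[OF cop] by blast
  then have "n dvd (k * k' - 1) * (e * B)" by (simp add: cong_iff_dvd_diff)
  \<comment> \<open>\<open>f\<close> solves \<open>k f = e B\<close> modulo \<open>n\<close>. Then
    \<open>n\<close> divides \<open>lam * e * f + B\<close> and \<open>lam * f^2 + l\<close>, as is
    seen after multiplication by \<open>k\<close>, a unit modulo \<open>n\<close>.\<close>
  define f where "f = k' * (e * B)"
  have f: "n dvd k * f - e * B"
    using \<open>n dvd (k * k' - 1) * (e * B)\<close> by (simp add: f_def algebra_simps)
  have "k * (lam * e * f + B) = lam * e * (k * f - e * B) + B * (lam * e\<^sup>2 + k)"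
    by (simp add: power2_eq_square algebra_simps)
  then have "n dvd k * (lam * e * f + B)" using f e by simp
  then have "n dvd lam * e * f + B" using cop by (metis coprime_commute coprime_dvd_mult_right_iff)
  then obtain E where E: "lam * e * f + B = n * E" by blast
  have "k * (k * (lam * f\<^sup>2 + l)) = lam * (k * f + e * B) * (k * f - e * B) + B\<^sup>2 * (lam * e\<^sup>2 + k) + k * D"
    unfolding kl[symmetric] by (simp add: power2_eq_square algebra_simps)
  then have "n dvd k * (k * (lam * f\<^sup>2 + l))" using f e nD by simp
  then have "n dvd lam * f\<^sup>2 + l" using cop by (metis coprime_commute coprime_dvd_mult_right_iff)
  then obtain C where C: "lam * f\<^sup>2 + l = n * C" by blast
  obtain A where A: "lam * e\<^sup>2 + k = n * A" using e by blast
  have lam: "lam > 0" using cases by auto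
  define V where "V = tern_vals (lam * n) A C E (lam * f) (lam * e)"
  \<comment> \<open>\<open>n\<close> times the form is \<open>lam\<close> times the square of
    \<open>n x + e y + f z\<close> plus a binary form of determinant \<open>D\<close>, so the form
    has determinant \<open>lam * D / n = 3\<close>.\<close>
  have "n * tern_det (lam * n) A C E (lam * f) (lam * e)
      = lam * ((n*A)*(n*C) + 2*(lam*e*f)*(n*E) - (n*E)\<^sup>2 - (n*A)*lam*f\<^sup>2 - (n*C)*lam*e\<^sup>2)"
    by (simp add: tern_det_def power2_eq_square algebra_simps)
  also have "\<dots> = lam * D"
    unfolding A[symmetric] C[symmetric] E[symmetric] kl[symmetric]
    by (simp add: power2_eq_square algebra_simps)
  finally have det: "tern_det (lam * n) A C E (lam * f) (lam * e) = 3" using D n by simp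
  have "lam * n * A - (lam * e)\<^sup>2 = lam * (n * A) - (lam * e)\<^sup>2" by simp
  also have "\<dots> = lam * k" unfolding A[symmetric] by (simp add: power2_eq_square algebra_simps)
  finally have "pos_form3 V (lam * n) A C E (lam * f) (lam * e)"
    using lam n k det by (simp add: pos_form3_def V_def)
  then have V: "V = tern_vals 1 1 3 0 0 0 \<or> V = tern_vals 1 2 2 1 0 0"
    by (rule pos_form3_reduced)
  \<comment> \<open>The value 6 tells the two reduced forms apart:
    \<open>x^2 + 2 y^2 + 2 y z + 2 z^2\<close> takes it at \<open>(2, 1, 0)\<close>, whereas
    \<open>V\<close> omits it by a descent modulo 3.\<close>
  have "6 \<notin> V"
  proof
    assume "6 \<in> V"
    then obtain x y z where xyz: "tern (lam * n) A C E (lam * f) (lam * e) x y z = 6"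
      by (auto simp: V_def tern_vals_def)
    \<comment> \<open>Multiplication by \<open>k n\<close> completes the squares and makes the form
      diagonal in \<open>W\<close>, \<open>w\<close>, \<open>z\<close>.\<close>
    define W w where "W = n * x + e * y + f * z" and "w = k * y + B * z"
    have "k * (n * 6) = k * (n * tern (lam * n) A C E (lam * f) (lam * e) x y z)" using xyz by simp
    also have "n * tern (lam * n) A C E (lam * f) (lam * e) x y z =
        lam * n\<^sup>2 * x\<^sup>2 + (n*A)*y\<^sup>2 + (n*C)*z\<^sup>2 + 2*(n*E)*y*z + 2*n*lam*f*x*z + 2*n*lam*e*x*y"
      by (simp add: tern_def power2_eq_square algebra_simps)
    also have "k * \<dots> = lam * k * W\<^sup>2 + w\<^sup>2 + D * z\<^sup>2"
      unfolding A[symmetric] C[symmetric] E[symmetric] kl[symmetric] W_def w_def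
      by (simp add: power2_eq_square algebra_simps)
    finally have main: "k * (n * 6) = lam * k * W\<^sup>2 + w\<^sup>2 + D * z\<^sup>2" .
    show False using cases
    proof
      assume 1: "lam = 1 \<and> k mod 3 = 1 \<and> \<not> 3 dvd n"
      then have k3: "3 dvd k - 1" by presburger
      \<comment> \<open>Here \<open>D = 3 n\<close> vanishes modulo 3, so 3 divides \<open>W\<close>
        and \<open>w\<close>. After division by 3 it must divide \<open>n (z^2 + 1)\<close>, which
        is impossible.\<close>
      have "W\<^sup>2 + w\<^sup>2 = 3 * (k * n * 2 - n * z\<^sup>2) - (k - 1) * W\<^sup>2"
        using main D 1 by (simp add: algebra_simps)
      then have "3 dvd W\<^sup>2 + w\<^sup>2" using k3 by simp
      then have "3 dvd W" "3 dvd w" by (rule three_dvd_sum_squares)+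
      then obtain W' w' where "W = 3 * W'" "w = 3 * w'" by (elim dvdE)
      then have "n * (z\<^sup>2 + 1) = 3 * (n - k * W'\<^sup>2 - w'\<^sup>2) + (k - 1) * (n * 2)"
        using main D 1 by (simp add: algebra_simps)
      then have "3 dvd n * (z\<^sup>2 + 1)" using k3 by simp
      then show False using 1 three_sum_two_squares_nonzero[of z] by (simp add: prime_dvd_mult_iff)
    next
      assume 3: "lam = 3 \<and> n mod 3 = 1"
      then have n3: "3 dvd n - 1" by presburger
      \<comment> \<open>Now \<open>D = n\<close> is 1 modulo 3 and \<open>W\<close> and
        \<open>z\<close> exchange roles. If 3 divided \<open>k\<close>, then \<open>B^2 + 1\<close>
        would be a multiple of 3.\<close>
      have k3: "\<not> 3 dvd k"
      proof
        assume "3 dvd k"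
        then have "3 dvd k * l - (n - 1)" using n3 by simp
        moreover have "k * l - (n - 1) = B\<^sup>2 + 1" using kl D 3 by simp
        ultimately show False using three_sum_two_squares_nonzero[of B] by simp
      qed
      have "w\<^sup>2 + z\<^sup>2 = 3 * (k * n * 2 - k * W\<^sup>2) - (n - 1) * z\<^sup>2"
        using main D 3 by (simp add: algebra_simps)
      then have "3 dvd w\<^sup>2 + z\<^sup>2" using n3 by simp
      then have "3 dvd w" "3 dvd z" by (rule three_dvd_sum_squares)+
      then obtain w' z' where "w = 3 * w'" "z = 3 * z'" by (elim dvdE)
      then have "k * (W\<^sup>2 + 1) = 3 * (k - w'\<^sup>2 - n * z'\<^sup>2) + (n - 1) * (k * 2)"
        using main D 3 by (simp add: algebra_simps)
      then have "3 dvd k * (W\<^sup>2 + 1)" using n3 by simp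
      then show False using k3 three_sum_two_squares_nonzero[of W] by (simp add: prime_dvd_mult_iff)
    qed
  qed
  moreover have "tern 1 2 2 1 0 0 2 1 0 = 6" by (simp add: tern_def)
  ultimately have "V = tern_vals 1 1 3 0 0 0" using V by (metis tern_in_vals)
  moreover have "tern (lam * n) A C E (lam * f) (lam * e) 1 0 0 = lam * n" by (simp add: tern_def)
  ultimately have "lam * n \<in> tern_vals 1 1 3 0 0 0" by (metis V_def tern_in_vals)
  then show ?thesis by (auto simp: tern_vals_def tern_def)
qed

section \<open>Power series of convolutions of periodic sequences\<close>

text \<open>\<open>summable_on\<close> over the reals is absolute convergence; the point is that one
  \<open>C\<close> serves all \<open>x\<close> below 1. This takes the place of regularity of a
  Dirichlet series at \<open>s = 1\<close>.\<close>

definition abel_bounded :: "(nat \<Rightarrow> real) \<Rightarrow> bool" where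
  "abel_bounded a \<longleftrightarrow> (\<exists>C. \<forall>x. 0 < x \<and> x < 1 \<longrightarrow>
     (\<lambda>m. a m * x ^ m) summable_on {1..} \<and> \<bar>\<Sum>\<^sub>\<infinity>m\<in>{1..}. a m * x ^ m\<bar> \<le> C)"

lemma abel_bounded_cong:
  assumes "\<And>m. m \<ge> 1 \<Longrightarrow> a m = b m"
  shows "abel_bounded a \<longleftrightarrow> abel_bounded b"
proof -
  have "((\<lambda>m. a m * x ^ m) summable_on {1..}) = ((\<lambda>m. b m * x ^ m) summable_on {1..})"
    "(\<Sum>\<^sub>\<infinity>m\<in>{1..}. a m * x ^ m) = (\<Sum>\<^sub>\<infinity>m\<in>{1..}. b m * x ^ m)" for x
    using assms by (auto intro!: summable_on_cong infsum_cong)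
  then show ?thesis by (simp add: abel_bounded_def)
qed

lemma abel_bounded_cmult: "abel_bounded a \<Longrightarrow> abel_bounded (\<lambda>m. c * a m)"
proof -
  assume "abel_bounded a"
  then obtain C where C: "\<And>x. 0 < x \<Longrightarrow> x < 1 \<Longrightarrow>
     (\<lambda>m. a m * x ^ m) summable_on {1..} \<and> \<bar>\<Sum>\<^sub>\<infinity>m\<in>{1..}. a m * x ^ m\<bar> \<le> C"
    by (auto simp: abel_bounded_def)
  have "(\<lambda>m. c * a m * x ^ m) summable_on {1..} \<and> \<bar>\<Sum>\<^sub>\<infinity>m\<in>{1..}. c * a m * x ^ m\<bar> \<le> \<bar>c\<bar> * C"
    if "0 < x" "x < 1" for x
    using C[OF that] by (simp add: mult.assoc summable_on_cmult_right infsum_cmult_right'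
        abs_mult mult_left_mono)
  then show ?thesis unfolding abel_bounded_def by blast
qed

lemma abel_bounded_add:
  assumes "abel_bounded a" "abel_bounded b"
  shows "abel_bounded (\<lambda>m. a m + b m)"
proof -
  obtain C where C: "\<And>x. 0 < x \<Longrightarrow> x < 1 \<Longrightarrow>
     (\<lambda>m. a m * x ^ m) summable_on {1..} \<and> \<bar>\<Sum>\<^sub>\<infinity>m\<in>{1..}. a m * x ^ m\<bar> \<le> C"
    using assms(1) by (auto simp: abel_bounded_def)
  obtain D where D: "\<And>x. 0 < x \<Longrightarrow> x < 1 \<Longrightarrow>
     (\<lambda>m. b m * x ^ m) summable_on {1..} \<and> \<bar>\<Sum>\<^sub>\<infinity>m\<in>{1..}. b m * x ^ m\<bar> \<le> D"
    using assms(2) by (auto simp: abel_bounded_def)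
  have "(\<lambda>m. (a m + b m) * x ^ m) summable_on {1..} \<and>
      \<bar>\<Sum>\<^sub>\<infinity>m\<in>{1..}. (a m + b m) * x ^ m\<bar> \<le> C + D"
    if "0 < x" "x < 1" for x
    using C[OF that] D[OF that]
    by (auto simp: distrib_right infsum_add intro!: summable_on_add)
  then show ?thesis unfolding abel_bounded_def by blast
qed

lemma abel_bounded_sum:
  assumes "finite S" "\<And>i. i \<in> S \<Longrightarrow> abel_bounded (a i)"
  shows "abel_bounded (\<lambda>m. \<Sum>i\<in>S. a i m)"
  using assms
proof (induction rule: finite_induct)
  case empty
  then show ?case by (auto simp: abel_bounded_def)
next
  case (insert i S)
  then show ?case by (simp add: abel_bounded_add)
qed

text \<open>With nonnegative terms a partial sum is at most the whole series; then \<open>x\<close>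
  tends to 1 in the finite sum.\<close>

lemma abel_bounded_nonneg_partial_sums:
  assumes "abel_bounded a" "\<And>m. m \<ge> 1 \<Longrightarrow> a m \<ge> 0"
  shows "\<exists>C. \<forall>n. (\<Sum>m=1..n. a m) \<le> C"
proof -
  obtain C where C: "\<And>x. 0 < x \<Longrightarrow> x < 1 \<Longrightarrow>
     (\<lambda>m. a m * x ^ m) summable_on {1..} \<and> \<bar>\<Sum>\<^sub>\<infinity>m\<in>{1..}. a m * x ^ m\<bar> \<le> C"
    using assms(1) by (auto simp: abel_bounded_def)
  have "(\<Sum>m=1..n. a m) \<le> C" for n
  proof -
    have le: "(\<Sum>m=1..n. a m * x ^ m) \<le> C" if "0 < x" "x < 1" for x
    proof -
      have "(\<Sum>m=1..n. a m * x ^ m) \<le> (\<Sum>\<^sub>\<infinity>m\<in>{1..}. a m * x ^ m)"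
        using C[OF that] assms(2) that by (intro finite_sum_le_infsum) auto
      then show ?thesis using C[OF that] by linarith
    qed
    have "((\<lambda>x. \<Sum>m=1..n. a m * x ^ m) \<longlongrightarrow> (\<Sum>m=1..n. a m * 1 ^ m)) (at_left 1)"
      by (intro tendsto_intros)
    moreover have "\<forall>\<^sub>F x in at_left (1::real). (\<Sum>m=1..n. a m * x ^ m) \<le> C"
      using eventually_at_left_real[OF zero_less_one] by eventually_elim (rule le, simp_all)
    ultimately have "(\<Sum>m=1..n. a m * 1 ^ m) \<le> C"
      by (intro tendsto_upperbound) auto
    then show ?thesis by simp
  qed
  then show ?thesis by blast
qed

section \<open>Periodic sequences with vanishing sum over a period\<close>

lemma sum_lessThan_add:
  fixes f :: "nat \<Rightarrow> 'a::comm_monoid_add"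
  shows "sum f {..<m + n} = sum f {..<m} + (\<Sum>k<n. f (m + k))"
  by (induction n) (simp_all add: add.assoc)

text \<open>Full periods cancel, so only an incomplete one contributes.\<close>

lemma periodic_zero_sum_bounded:
  fixes f :: "nat \<Rightarrow> real"
  assumes "M > 0" "\<And>n. f (M + n) = f n" "sum f {..<M} = 0"
  shows "\<exists>C. \<forall>n. \<bar>sum f {..<n}\<bar> \<le> C"
proof -
  have "\<bar>sum f {..<n}\<bar> \<le> (\<Sum>k<M. \<bar>f k\<bar>)" for n
  proof (induction n rule: less_induct)
    case (less n)
    show ?case
    proof (cases "n < M")
      case True
      then have "(\<Sum>k<n. \<bar>f k\<bar>) \<le> (\<Sum>k<M. \<bar>f k\<bar>)" by (intro sum_mono2) auto
      then show ?thesis using sum_abs[of f "{..<n}"] by linarith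
    next
      case False
      then have "sum f {..<n} = sum f {..<n - M}"
        using sum_lessThan_add[of f M "n - M"] assms by simp
      then show ?thesis using less.IH[of "n - M"] False assms(1) by simp
    qed
  qed
  then show ?thesis by blast
qed

lemma periodic_bounded:
  fixes f :: "nat \<Rightarrow> real"
  assumes "M > 0" "\<And>n. f (M + n) = f n"
  shows "\<bar>f n\<bar> \<le> (\<Sum>k<M. \<bar>f k\<bar>)"
proof (induction n rule: less_induct)
  case (less n)
  show ?case
  proof (cases "n < M")
    case True
    then show ?thesis by (intro member_le_sum) auto
  next
    case False
    then have "f n = f (n - M)" using assms(2)[of "n - M"] by simp
    then show ?thesis using less.IH[of "n - M"] False assms(1) by simp
  qed
qed

lemma summable_bounded_power_series:
  fixes g :: "nat \<Rightarrow> real"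
  assumes "\<And>n. \<bar>g n\<bar> \<le> B" "0 \<le> y" "y < 1"
  shows "summable (\<lambda>n. g n * y ^ n)"
proof (rule summable_comparison_test)
  show "\<exists>N. \<forall>n\<ge>N. norm (g n * y ^ n) \<le> B * y ^ n"
    using assms by (auto simp: abs_mult mult_right_mono)
  show "summable (\<lambda>n. B * y ^ n)" using assms by (simp add: summable_mult summable_geometric)
qed

text \<open>The power series of a periodic sequence with vanishing sum over a period is a quotient of
  polynomials without pole on \<open>[0, 1]\<close>.\<close>

lemma periodic_power_series_lipschitz:
  fixes g :: "nat \<Rightarrow> real"
  assumes M: "M > 0" and per: "\<And>n. g (M + n) = g n" and zero: "sum g {..<M} = 0"
  shows "\<exists>K\<ge>0. \<forall>y z. 0 \<le> y \<and> y < 1 \<and> 0 \<le> z \<and> z < 1 \<longrightarrow>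
    \<bar>(\<Sum>n. g n * y ^ n) - (\<Sum>n. g n * z ^ n)\<bar> \<le> K * \<bar>y - z\<bar>"
proof -
  define H where "H = (\<lambda>y. \<Sum>n. g n * y ^ n)"
  \<comment> \<open>Periodicity gives \<open>(1 - y^M) H(y) = N(y)\<close>; moreover
    \<open>1 - y^M = (1 - y) S(y)\<close>, and \<open>N(1) = 0\<close> gives
    \<open>N = (y - 1) P\<close>. Hence \<open>H = - P / S\<close>, with \<open>S \<ge> 1\<close>
    for \<open>y \<ge> 0\<close>.\<close>
  define N where "N = (\<Sum>k<M. Polynomial.monom (g k) k)"
  define S where "S = (\<Sum>k<M. Polynomial.monom (1::real) k)"
  have polyN: "poly N y = (\<Sum>k<M. g k * y ^ k)" and polyS: "poly S y = (\<Sum>k<M. y ^ k)" for y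
    by (simp_all add: N_def S_def poly_sum Polynomial.poly_monom)
  have "poly N 1 = 0" using zero by (simp add: polyN)
  then obtain P where P: "N = [:-1, 1:] * P" unfolding poly_eq_0_iff_dvd by (auto elim: dvdE)
  have S_pos: "poly S y \<ge> 1" if "0 \<le> y" for y
  proof -
    have "(\<Sum>k<1. y ^ k) \<le> (\<Sum>k<M. y ^ k)" using M that by (intro sum_mono2) auto
    then show ?thesis by (simp add: polyS)
  qed
  have H_eq: "H y = - poly P y / poly S y" if "0 \<le> y" "y < 1" for y
  proof -
    have s: "summable (\<lambda>n. g n * y ^ n)"
      using summable_bounded_power_series[OF periodic_bounded[of M g, OF M per] that] .
    have "H y = (\<Sum>n. g (n + M) * y ^ (n + M)) + (\<Sum>k<M. g k * y ^ k)"
      unfolding H_def by (rule suminf_split_initial_segment[OF s])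
    also have "(\<lambda>n. g (n + M) * y ^ (n + M)) = (\<lambda>n. y ^ M * (g n * y ^ n))"
      using per by (simp add: add.commute[of _ M] power_add mult.left_commute)
    also have "(\<Sum>n. y ^ M * (g n * y ^ n)) = y ^ M * H y" unfolding H_def by (rule suminf_mult[OF s])
    finally have "(1 - y ^ M) * H y = poly N y" by (simp add: polyN algebra_simps)
    then have "(1 - y) * (poly S y * H y) = (1 - y) * - poly P y"
      using one_diff_power_eq[of y M] by (simp add: P polyS algebra_simps)
    then have "poly S y * H y = - poly P y" using that by (subst (asm) mult_cancel_left) simp
    then show ?thesis using S_pos[OF that(1)] by (simp add: field_simps)
  qed
  \<comment> \<open>The derivative of \<open>- P / S\<close>, continuous and so bounded on the
    closed interval; its bound is the Lipschitz constant.\<close>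
  define D where "D = (\<lambda>y. (- poly (pderiv P) y * poly S y + poly P y * poly (pderiv S) y) / (poly S y * poly S y))"
  have "compact (D ` {0..1})"
    unfolding D_def
    by (intro compact_continuous_image continuous_intros compact_Icc) (use S_pos in force)
  then obtain K where K: "\<And>y. y \<in> {0..1} \<Longrightarrow> norm (D y) \<le> K"
    using compact_imp_bounded bounded_iff by (metis imageI)
  have "norm (- poly P y / poly S y - (- poly P z / poly S z)) \<le> K * norm (y - z)"
    if "y \<in> {0..1}" "z \<in> {0..1}" for y z
  proof (rule field_differentiable_bound[where S = "{0..1}" and f' = D])
    fix u :: real assume u: "u \<in> {0..1}"
    then show "((\<lambda>y. - poly P y / poly S y) has_field_derivative D u) (at u within {0..1})"
      unfolding D_def using S_pos[of u]
      by (auto intro!: derivative_eq_intros simp: field_simps)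
    show "norm (D u) \<le> K" using K u by blast
  qed (use that in auto)
  then have "\<bar>H y - H z\<bar> \<le> K * \<bar>y - z\<bar>" if "0 \<le> y \<and> y < 1 \<and> 0 \<le> z \<and> z < 1" for y z
    using that by (simp add: H_eq)
  moreover have "K \<ge> 0" using K[of 0] norm_ge_zero[of "D 0"] by (auto intro: order_trans)
  ultimately show ?thesis unfolding H_def by blast
qed

section \<open>Convolutions of periodic sequences\<close>

lemma abel_summation:
  fixes f h :: "nat \<Rightarrow> real"
  shows "(\<Sum>d<n. f d * h d) = sum f {..<n} * h n + (\<Sum>d<n. sum f {..<Suc d} * (h d - h (Suc d)))"
  by (induction n) (simp_all add: algebra_simps)

text \<open>The series is the sum over \<open>d \<ge> 1\<close> of \<open>f(d) H(x^d)\<close>, with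
  \<open>H\<close> the power series of \<open>g\<close>. Partial sums of \<open>f\<close> are
  bounded, and as \<open>H\<close> is Lipschitz the variation of \<open>H(x^d)\<close> in
  \<open>d\<close> telescopes to at most \<open>K\<close>; Abel summation then bounds the series
  uniformly in \<open>x\<close>.\<close>

lemma convolution_abel_bounded:
  fixes f g :: "nat \<Rightarrow> real"
  assumes M: "M > 0"
    and f: "\<And>n. f (M + n) = f n" "sum f {..<M} = 0" "f 0 = 0"
    and g: "\<And>n. g (M + n) = g n" "sum g {..<M} = 0" "g 0 = 0"
  shows "abel_bounded (\<lambda>m. \<Sum>d | d dvd m. f d * g (m div d))"
proof -
  obtain C where C: "\<And>n. \<bar>sum f {..<n}\<bar> \<le> C"
    using periodic_zero_sum_bounded[OF M f(1,2)] by blast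
  then have C0: "C \<ge> 0" by (meson abs_ge_zero order_trans)
  define H where "H = (\<lambda>y. \<Sum>n. g n * y ^ n)"
  obtain K where K0: "K \<ge> 0" and K: "\<And>y z. 0 \<le> y \<Longrightarrow> y < 1 \<Longrightarrow> 0 \<le> z \<Longrightarrow> z < 1 \<Longrightarrow>
      \<bar>H y - H z\<bar> \<le> K * \<bar>y - z\<bar>"
    using periodic_power_series_lipschitz[OF M g(1,2)] unfolding H_def by blast
  have H0: "H 0 = 0" using g(3) by (simp add: H_def powser_zero)
  define Bf Bg where "Bf = (\<Sum>k<M. \<bar>f k\<bar>)" and "Bg = (\<Sum>k<M. \<bar>g k\<bar>)"
  have Bf: "\<bar>f n\<bar> \<le> Bf" and Bg: "\<bar>g n\<bar> \<le> Bg" for n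
    unfolding Bf_def Bg_def by (intro periodic_bounded M f(1) g(1))+
  have B0: "Bf \<ge> 0" "Bg \<ge> 0" by (simp_all add: Bf_def Bg_def sum_nonneg)
  have partial: "\<bar>\<Sum>d<n. f (Suc d) * H (x ^ Suc d)\<bar> \<le> 2 * C * K" if x: "0 < x" "x < 1" for x n
  proof -
    \<comment> \<open>Indices start at 0 but stand for \<open>Suc d\<close>; the shift costs nothing
      because \<open>f 0 = 0\<close>.\<close>
    let ?h = "\<lambda>d. H (x ^ Suc d)"
    have F: "(\<Sum>k<n. f (Suc k)) = sum f {..<Suc n}" for n
      unfolding sum.lessThan_Suc_shift by (simp add: f(3))
    have xl: "x ^ Suc d < 1" for d using x by (simp add: power_less_one_iff del: power_Suc)
    have dec: "x ^ Suc (Suc d) \<le> x ^ Suc d" for d using x by (intro power_decreasing) auto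
    \<comment> \<open>Boundary term of the Abel summation: since \<open>H 0 = 0\<close>, the
      Lipschitz bound also bounds \<open>H\<close> itself.\<close>
    have "\<bar>?h n\<bar> \<le> K * \<bar>x ^ Suc n - 0\<bar>" using K[of "x ^ Suc n" 0] x xl H0 by simp
    also have "\<dots> \<le> K * 1" using x xl[of n] K0 by (intro mult_left_mono) (auto simp: abs_le_iff less_imp_le)
    finally have hn: "\<bar>?h n\<bar> \<le> K" by simp
    have "\<bar>\<Sum>d<n. (\<Sum>k<Suc d. f (Suc k)) * (?h d - ?h (Suc d))\<bar>
        \<le> (\<Sum>d<n. C * (K * (x ^ Suc d - x ^ Suc (Suc d))))"
    proof (rule order_trans[OF sum_abs sum_mono])
      fix d
      have "\<bar>?h d - ?h (Suc d)\<bar> \<le> K * \<bar>x ^ Suc d - x ^ Suc (Suc d)\<bar>"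
        using x xl[of d] xl[of "Suc d"] by (intro K zero_le_power) (simp_all only: less_imp_le)
      also have "\<dots> = K * (x ^ Suc d - x ^ Suc (Suc d))" using dec[of d] by simp
      finally show "\<bar>(\<Sum>k<Suc d. f (Suc k)) * (?h d - ?h (Suc d))\<bar> \<le> C * (K * (x ^ Suc d - x ^ Suc (Suc d)))"
        unfolding abs_mult F by (intro mult_mono C C0 abs_ge_zero)
    qed
    also have "\<dots> = C * (K * (\<Sum>d<n. x ^ Suc d - x ^ Suc (Suc d)))"
      by (simp add: sum_distrib_left)
    also have "(\<Sum>d<n. x ^ Suc d - x ^ Suc (Suc d)) = x - x ^ Suc n"
      by (induction n) simp_all
    also have "C * (K * (x - x ^ Suc n)) \<le> C * (K * 1)"
      using x C0 K0 by (intro mult_left_mono) (auto intro: order_trans[of _ x])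
    finally have 1: "\<bar>\<Sum>d<n. (\<Sum>k<Suc d. f (Suc k)) * (?h d - ?h (Suc d))\<bar> \<le> C * K" by simp
    have "\<bar>(\<Sum>k<n. f (Suc k)) * ?h n\<bar> \<le> C * K"
      unfolding abs_mult F by (intro mult_mono hn C C0 abs_ge_zero)
    then show ?thesis using 1 abel_summation[of "\<lambda>d. f (Suc d)" ?h n] by linarith
  qed
  have "(\<lambda>m. (\<Sum>d | d dvd m. f d * g (m div d)) * x ^ m) summable_on {1..} \<and>
     \<bar>\<Sum>\<^sub>\<infinity>m\<in>{1..}. (\<Sum>d | d dvd m. f d * g (m div d)) * x ^ m\<bar> \<le> 2 * C * K"
    if x: "0 < x" "x < 1" for x
  proof -
    define t where "t = (\<lambda>d e. f (Suc d) * g (Suc e) * x ^ (Suc d * Suc e))"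
    have geo: "((\<lambda>e. x ^ e) has_sum (1 / (1 - x))) UNIV"
      using x by (intro norm_summable_imp_has_sum geometric_sums) (auto simp: summable_geometric)
    \<comment> \<open>Absolute convergence of the double series comes from comparison with
      \<open>x^(d + e)\<close>, as \<open>d + e \<le> (d + 1) * (e + 1)\<close>.\<close>
    have "(\<lambda>(d, e). x ^ d * x ^ e) summable_on (UNIV \<times> UNIV)"
    proof (rule summable_on_SigmaI)
      show "((\<lambda>e. case (d, e) of (d, e) \<Rightarrow> x ^ d * x ^ e) has_sum (x ^ d * (1 / (1 - x)))) UNIV" for d
        using has_sum_cmult_right[OF geo] by simp
      show "(\<lambda>d. x ^ d * (1 / (1 - x))) summable_on UNIV"
        using geo by (intro summable_on_cmult_left) (auto simp: summable_on_def)
    qed (use x in auto)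
    then have "(\<lambda>p. Bf * Bg * (case p of (d, e) \<Rightarrow> x ^ d * x ^ e)) summable_on (UNIV \<times> UNIV)"
      by (rule summable_on_cmult_right)
    then have "(\<lambda>(d, e). t d e) abs_summable_on (UNIV \<times> UNIV)"
    proof (rule abs_summable_on_comparison_test')
      fix p :: "nat \<times> nat"
      obtain d e where p: "p = (d, e)" by fastforce
      have "\<bar>t d e\<bar> = \<bar>f (Suc d)\<bar> * \<bar>g (Suc e)\<bar> * x ^ (Suc d * Suc e)"
        using x by (simp add: t_def abs_mult)
      also have "\<dots> \<le> Bf * Bg * x ^ (d + e)"
        using x B0 by (intro mult_mono Bf Bg power_decreasing) auto
      finally show "norm (case p of (d, e) \<Rightarrow> t d e) \<le> Bf * Bg * (case p of (d, e) \<Rightarrow> x ^ d * x ^ e)"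
        by (simp add: p power_add)
    qed
    then have sm: "(\<lambda>(d, e). t d e) summable_on (UNIV \<times> UNIV)" by (rule abs_summable_summable)
    have inner: "(\<Sum>\<^sub>\<infinity>e. t d e) = f (Suc d) * H (x ^ Suc d)" for d
    proof -
      let ?y = "x ^ Suc d"
      have y: "0 \<le> ?y" "?y < 1" using x by (auto simp: power_less_one_iff simp del: power_Suc)
      have s: "summable (\<lambda>n. g n * ?y ^ n)" and "summable (\<lambda>n. \<bar>g n\<bar> * ?y ^ n)"
        using summable_bounded_power_series[OF _ y, of g Bg] 
          summable_bounded_power_series[OF _ y, of "\<lambda>n. \<bar>g n\<bar>" Bg] Bg by auto
      then have s': "summable (\<lambda>n. norm (g (Suc n) * ?y ^ Suc n))"
        using y by (subst summable_Suc_iff) (simp add: abs_mult)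
      have "(\<lambda>n. g (Suc n) * ?y ^ Suc n) sums H ?y"
        using s g(3) unfolding H_def by (subst sums_Suc_iff) (simp add: summable_sums)
      then have "((\<lambda>n. g (Suc n) * ?y ^ Suc n) has_sum H ?y) UNIV"
        by (rule norm_summable_imp_has_sum[OF s'])
      then have "((\<lambda>n. f (Suc d) * (g (Suc n) * ?y ^ Suc n)) has_sum f (Suc d) * H ?y) UNIV"
        by (rule has_sum_cmult_right)
      then have "((\<lambda>e. t d e) has_sum f (Suc d) * H ?y) UNIV"
        unfolding t_def power_mult[of x "Suc d"] by (simp only: mult.assoc)
      then show ?thesis by (rule infsumI)
    qed
    have tot: "(\<Sum>\<^sub>\<infinity>(d, e)\<in>UNIV \<times> UNIV. t d e) = (\<Sum>\<^sub>\<infinity>d. f (Suc d) * H (x ^ Suc d))"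
      using infsum_Sigma'_banach[OF sm] by (simp add: inner)
    have "(\<lambda>d. f (Suc d) * H (x ^ Suc d)) summable_on UNIV"
      using summable_on_Sigma_banach[OF sm] by (simp add: inner)
    then have "(\<lambda>d. f (Suc d) * H (x ^ Suc d)) sums (\<Sum>\<^sub>\<infinity>d. f (Suc d) * H (x ^ Suc d))"
      by (intro has_sum_imp_sums has_sum_infsum)
    then have "(\<lambda>n. \<bar>\<Sum>d<n. f (Suc d) * H (x ^ Suc d)\<bar>) \<longlonglongrightarrow> \<bar>\<Sum>\<^sub>\<infinity>d. f (Suc d) * H (x ^ Suc d)\<bar>"
      unfolding sums_def by (rule tendsto_rabs)
    then have bound: "\<bar>\<Sum>\<^sub>\<infinity>(d, e)\<in>UNIV \<times> UNIV. t d e\<bar> \<le> 2 * C * K"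
      unfolding tot by (rule LIMSEQ_le_const2) (use partial[OF x] in blast)
    define T where "T = (SIGMA m:{1::nat..}. {d. d dvd m})"
    define u where "u = (\<lambda>m d. f d * g (m div d) * x ^ m)"
    \<comment> \<open>A pair of positive factors, shifted by \<open>Suc\<close>, corresponds to
      their product together with the chosen divisor.\<close>
    define \<phi> where "\<phi> = (\<lambda>(d, e). (Suc d * Suc e, Suc d))"
    have bij: "bij_betw \<phi> (UNIV \<times> UNIV) T"
    proof (rule bij_betwI')
      show "\<phi> p \<in> T" if "p \<in> UNIV \<times> UNIV" for p 
        by (cases p) (auto simp: \<phi>_def T_def simp del: mult_Suc mult_Suc_right)
      show "(\<phi> p = \<phi> q) = (p = q)" for p q
        by (cases p; cases q) (auto simp: \<phi>_def simp del: mult_Suc mult_Suc_right)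
      show "\<exists>p\<in>UNIV \<times> UNIV. y = \<phi> p" if yT: "y \<in> T" for y
      proof -
        obtain m d where y: "y = (m, d)" "m \<ge> 1" "d dvd m" using yT unfolding T_def by blast
        then obtain e where "m = d * e" by blast
        then have "y = \<phi> (d - 1, e - 1)" using y by (auto simp: \<phi>_def simp del: mult_Suc mult_Suc_right)
        then show ?thesis by blast
      qed
    qed
    have ut: "(case \<phi> p of (m, d) \<Rightarrow> u m d) = (case p of (d, e) \<Rightarrow> t d e)" for p
      by (cases p) (simp add: \<phi>_def u_def t_def del: mult_Suc mult_Suc_right)
    have usm: "(\<lambda>(m, d). u m d) summable_on T"
      using sm summable_on_reindex_bij_betw[OF bij, of "\<lambda>(m, d). u m d"] by (simp add: ut)
    have usum: "(\<Sum>\<^sub>\<infinity>(m, d)\<in>T. u m d) = (\<Sum>\<^sub>\<infinity>(d, e)\<in>UNIV \<times> UNIV. t d e)"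
      using infsum_reindex_bij_betw[OF bij, of "\<lambda>(m, d). u m d"] by (simp add: ut)
    have fin: "(\<Sum>\<^sub>\<infinity>d\<in>{d. d dvd m}. u m d) = (\<Sum>d | d dvd m. f d * g (m div d)) * x ^ m"
      if "m \<in> {1..}" for m
      using that by (subst infsum_finite) (auto simp: u_def sum_distrib_right)
    have "(\<lambda>m. \<Sum>\<^sub>\<infinity>d\<in>{d. d dvd m}. u m d) summable_on {1..}"
      using summable_on_Sigma_banach[OF usm[unfolded T_def]] .
    moreover have "(\<Sum>\<^sub>\<infinity>m\<in>{1..}. \<Sum>\<^sub>\<infinity>d\<in>{d. d dvd m}. u m d) = (\<Sum>\<^sub>\<infinity>(m, d)\<in>T. u m d)"
      unfolding T_def by (rule infsum_Sigma'_banach[OF usm[unfolded T_def]])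
    ultimately show ?thesis using bound usum
      by (simp only: summable_on_cong[OF fin] infsum_cong[OF fin])
  qed
  then show ?thesis unfolding abel_bounded_def by blast
qed

section \<open>Families of quadratic characters\<close>

text \<open>Each divisor of \<open>p ^ j * m\<close> is uniquely \<open>p ^ i * d\<close> with
  \<open>i \<le> j\<close> and \<open>d\<close> dividing \<open>m\<close>; the multiplicity of
  \<open>p\<close> recovers \<open>i\<close>.\<close>

lemma divisor_sum_prime_power_mult:
  fixes f :: "nat \<Rightarrow> int"
  assumes mult: "\<And>a b. f (a * b) = f a * f b" and one: "f 1 = 1"
    and p: "prime p" "\<not> p dvd m" and m: "m > 0"
  shows "(\<Sum>d | d dvd p ^ j * m. f d) = (\<Sum>i\<le>j. f p ^ i) * (\<Sum>d | d dvd m. f d)"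
proof -
  have pow: "f (p ^ i) = f p ^ i" for i by (induction i) (simp_all add: mult one[simplified])
  have bij: "bij_betw (\<lambda>(i, d). p ^ i * d) ({..j} \<times> {d. d dvd m}) {d. d dvd p ^ j * m}"
  proof (rule bij_betwI')
    fix x y assume xy: "x \<in> {..j} \<times> {d. d dvd m}" "y \<in> {..j} \<times> {d. d dvd m}"
    obtain i d i' d' where [simp]: "x = (i, d)" "y = (i', d')" by fastforce
    have nd: "\<not> p dvd d" "\<not> p dvd d'" "d \<noteq> 0" "d' \<noteq> 0"
      using xy p(2) m by (auto intro: dvd_trans)
    have mp: "multiplicity p (p ^ i * d) = i" if "\<not> p dvd d" "d \<noteq> 0" for i d
      using that p(1) by (simp add: prime_elem_multiplicity_mult_distrib prime_gt_0_nat
          not_dvd_imp_multiplicity_0)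
    show "((case x of (i, d) \<Rightarrow> p ^ i * d) = (case y of (i, d) \<Rightarrow> p ^ i * d)) = (x = y)"
    proof
      assume eq: "(case x of (i, d) \<Rightarrow> p ^ i * d) = (case y of (i, d) \<Rightarrow> p ^ i * d)"
      then have "i = i'" using mp[of d i] mp[of d' i'] nd by simp
      then show "x = y" using eq p(1) by (simp add: prime_gt_0_nat)
    qed auto
  next
    fix x assume "x \<in> {..j} \<times> {d. d dvd m}"
    then show "(case x of (i, d) \<Rightarrow> p ^ i * d) \<in> {d. d dvd p ^ j * m}"
      by (auto intro!: mult_dvd_mono le_imp_power_dvd)
  next
    fix y assume "y \<in> {d. d dvd p ^ j * m}"
    then obtain b c where bc: "y = b * c" "b dvd p ^ j" "c dvd m"
      using division_decomp[of y "p ^ j" m] by auto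
    then obtain i where "i \<le> j" "b = p ^ i" using p(1) divides_primepow_nat by blast
    then show "\<exists>x\<in>{..j} \<times> {d. d dvd m}. y = (case x of (i, d) \<Rightarrow> p ^ i * d)"
      using bc by (intro bexI[of _ "(i, c)"]) auto
  qed
  have "(\<Sum>d | d dvd p ^ j * m. f d) = (\<Sum>(i, d)\<in>{..j} \<times> {d. d dvd m}. f p ^ i * f d)"
    using sum.reindex_bij_betw[OF bij, of f] by (simp add: case_prod_unfold mult pow)
  then show ?thesis by (simp add: sum.cartesian_product[symmetric] sum_product)
qed

text \<open>The sum is a product of local factors \<open>1 + f p + ... + f p ^ j\<close>. Such a
  factor is \<open>j + 1\<close> for \<open>f p = 1\<close>, is 1 for \<open>f p = 0\<close>, and
  for \<open>f p = -1\<close> is 1 or 0 as \<open>j\<close> is even or odd. The claims follow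
  together by splitting off one prime at a time.\<close>

lemma divisor_sum_character:
  fixes f :: "nat \<Rightarrow> int"
  assumes mult: "\<And>a b. f (a * b) = f a * f b" and one: "f 1 = 1"
    and vals: "\<And>a. f a \<in> {-1, 0, 1}"
  shows "m > 0 \<Longrightarrow> (\<Sum>d | d dvd m. f d) \<ge> 0
    \<and> ((\<forall>p. prime p \<longrightarrow> even (multiplicity p m)) \<longrightarrow> (\<Sum>d | d dvd m. f d) \<ge> 1)
    \<and> ((\<Sum>d | d dvd m. f d) \<noteq> 0 \<longrightarrow> (\<forall>p. prime p \<longrightarrow> odd (multiplicity p m) \<longrightarrow> f p \<noteq> -1))"
proof (induction m rule: less_induct)
  case (less m)
  show ?case
  proof (cases "m = 1")
    case True
    then show ?thesis using one by simp
  next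
    case False
    then obtain p where p: "prime p" "p dvd m" using prime_factor_nat by blast
    define j where "j = multiplicity p m"
    obtain m' where m': "m = p ^ j * m'" "\<not> p dvd m'"
      using multiplicity_decompose'[of m p] less.prems p(1) unfolding j_def by (metis not_prime_unit not_gr_zero)
    have j: "j > 0" using p less.prems by (simp add: j_def prime_multiplicity_gt_zero_iff)
    have m'0: "m' > 0" using m' less.prems by (auto intro: Nat.gr0I)
    have "1 * m' < p ^ j * m'" 
      using j p(1) m'0 by (intro mult_strict_right_mono one_less_power prime_gt_1_nat)
    then have lt: "m' < m" using m' by simp
    note IH = less.IH[OF lt m'0]
    have mq: "multiplicity q m' = multiplicity q m" if "prime q" "q \<noteq> p" for q
      unfolding m'(1) using that p(1) m'0
      by (simp add: prime_elem_multiplicity_mult_distrib prime_gt_0_nat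
          multiplicity_distinct_prime_power del: power_eq_0_iff)
    have r: "(\<Sum>d | d dvd m. f d) = (\<Sum>i\<le>j. f p ^ i) * (\<Sum>d | d dvd m'. f d)"
      unfolding m'(1) by (rule divisor_sum_prime_power_mult[OF mult one p(1) m'(2) m'0])
    have alt: "(\<Sum>i\<le>n. (-1::int) ^ i) = (if even n then 1 else 0)" for n
      by (induction n) auto
    have zero: "(\<Sum>i\<le>n. (0::int) ^ i) = 1" for n
      by (induction n) auto
    have s: "(\<Sum>i\<le>j. f p ^ i) \<ge> 0" "even j \<Longrightarrow> (\<Sum>i\<le>j. f p ^ i) \<ge> 1"
      "odd j \<Longrightarrow> f p = -1 \<Longrightarrow> (\<Sum>i\<le>j. f p ^ i) = 0"
      using vals[of p] by (auto simp: alt zero)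
    show ?thesis
    proof (intro conjI impI allI)
      show "(\<Sum>d | d dvd m. f d) \<ge> 0" unfolding r using s IH by (intro mult_nonneg_nonneg) auto
    next
      assume ev: "\<forall>p. prime p \<longrightarrow> even (multiplicity p m)"
      have "even (multiplicity q m')" if "prime q" for q
        using ev mq[OF that] that m'(2) by (cases "q = p") (auto simp: not_dvd_imp_multiplicity_0)
      then have "(\<Sum>d | d dvd m'. f d) \<ge> 1" using IH by blast
      moreover have "(\<Sum>i\<le>j. f p ^ i) \<ge> 1" using s(2) ev p(1) by (simp add: j_def)
      ultimately have "1 * 1 \<le> (\<Sum>i\<le>j. f p ^ i) * (\<Sum>d | d dvd m'. f d)"
        by (intro mult_mono) auto
      then show "(\<Sum>d | d dvd m. f d) \<ge> 1" unfolding r by simp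
    next
      fix q assume nz: "(\<Sum>d | d dvd m. f d) \<noteq> 0" and q: "prime q" "odd (multiplicity q m)"
      show "f q \<noteq> -1"
      proof (cases "q = p")
        case True
        then show ?thesis using s(3) nz q unfolding r by (auto simp: j_def)
      next
        case False
        then show ?thesis using IH nz q mq[of q] unfolding r by auto
      qed
    qed
  qed
qed

section \<open>Products of real characters to coprime moduli\<close>

text \<open>An abstraction of genus characters: real characters to pairwise coprime moduli,
  nonprincipal by \<open>psi_minus\<close>.\<close>

locale quadratic_characters =
  fixes I :: "nat set" and \<psi> :: "nat \<Rightarrow> nat \<Rightarrow> int"
  assumes finite_I: "finite I" and nonempty: "I \<noteq> {}"
    and coprime_I: "\<And>q r. q \<in> I \<Longrightarrow> r \<in> I \<Longrightarrow> q \<noteq> r \<Longrightarrow> coprime q r"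
    and gt_1: "\<And>q. q \<in> I \<Longrightarrow> q > 1"
    and psi_mult: "\<And>q a b. q \<in> I \<Longrightarrow> \<psi> q (a * b) = \<psi> q a * \<psi> q b"
    and psi_cong: "\<And>q a b. q \<in> I \<Longrightarrow> [a = b] (mod q) \<Longrightarrow> \<psi> q a = \<psi> q b"
    and psi_zero: "\<And>q a. q \<in> I \<Longrightarrow> \<psi> q a = 0 \<longleftrightarrow> \<not> coprime a q"
    and psi_vals: "\<And>q a. q \<in> I \<Longrightarrow> \<psi> q a \<in> {-1, 0, 1}"
    and psi_minus: "\<And>q. q \<in> I \<Longrightarrow> \<exists>a. \<psi> q a = -1"
begin

text \<open>The product of the characters in \<open>T\<close>, extended to the modulus \<open>\<Prod>I\<close>: the squares are the
  principal characters of the remaining moduli.\<close>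

definition F :: "nat set \<Rightarrow> nat \<Rightarrow> int" where
  "F T m = (\<Prod>q\<in>I. if q \<in> T then \<psi> q m else (\<psi> q m)\<^sup>2)"

lemma psi_1: "q \<in> I \<Longrightarrow> \<psi> q 1 = 1"
  using psi_mult[of q 1 1] psi_zero[of q 1] by auto

lemma F_mult: "F T (a * b) = F T a * F T b"
  unfolding F_def prod.distrib[symmetric]
  by (intro prod.cong refl) (simp add: psi_mult power_mult_distrib)

lemma F_1: "F T 1 = 1"
  unfolding F_def by (intro prod.neutral) (auto simp: psi_1[simplified])

lemma F_zero: "F T 0 = 0"
proof -
  obtain q where q: "q \<in> I" using nonempty by blast
  then have "\<psi> q 0 = 0" using psi_zero[of q 0] gt_1[of q] by simp
  then show ?thesis unfolding F_def using q finite_I by (auto simp: prod_zero_iff)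
qed

lemma F_cong:
  assumes "[a = b] (mod (\<Prod>I))"
  shows "F T a = F T b"
proof -
  have "\<psi> q a = \<psi> q b" if "q \<in> I" for q
    using psi_cong[OF that] assms that finite_I by (meson cong_dvd_modulus_nat dvd_prodI)
  then show ?thesis unfolding F_def by (intro prod.cong) auto
qed

lemma F_vals: "F T a \<in> {-1, 0, 1}"
proof -
  have "(\<Prod>q\<in>J. if q \<in> T then \<psi> q a else (\<psi> q a)\<^sup>2) \<in> {-1, 0, 1}" if "J \<subseteq> I" for J
    using finite_subset[OF that finite_I] that
  proof (induction J rule: finite_induct)
    case (insert q J)
    have "x * y \<in> {-1, 0, 1}" if "x \<in> {-1, 0, 1}" "y \<in> {-1, 0, 1}" for x y :: int
      using that by auto
    moreover have "(if q \<in> T then \<psi> q a else (\<psi> q a)\<^sup>2) \<in> {-1, 0, 1}"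
      using psi_vals[of q a] insert.prems by auto
    ultimately show ?case unfolding prod.insert[OF insert.hyps] using insert.IH insert.prems by blast
  qed simp
  then show ?thesis unfolding F_def by blast
qed

lemma F_zero_iff: "F T a = 0 \<longleftrightarrow> (\<exists>q\<in>I. \<psi> q a = 0)"
  unfolding F_def using finite_I by (auto simp: prod_zero_iff split: if_splits)

text \<open>On -1, 0, 1 one has \<open>x * x = x^2\<close> and \<open>x^2 * x = x\<close>, so
  multiplication by the full character \<open>F I\<close> exchanges \<open>T\<close> with its
  complement.\<close>

lemma F_complement: "F T d * F I d = F (I - T) d"
proof -
  have "(if q \<in> T then \<psi> q d else (\<psi> q d)\<^sup>2) * \<psi> q d = (if q \<in> I - T then \<psi> q d else (\<psi> q d)\<^sup>2)"
    if "q \<in> I" for q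
    using psi_vals[OF that, of d] that by (auto simp: power2_eq_square)
  then show ?thesis unfolding F_def by (simp add: prod.distrib[symmetric] cong: prod.cong)
qed

lemma modulus_pos: "(\<Prod>I) > 0"
  using gt_1 by (intro prod_pos) force

text \<open>The Chinese remainder theorem yields a unit \<open>a\<close> at which just one
  character, belonging to \<open>T\<close>, is -1. Multiplication by \<open>a\<close> permutes the
  residues and reverses the sign of the sum.\<close>

lemma F_sum_zero:
  assumes T: "T \<inter> I \<noteq> {}"
  shows "(\<Sum>m<\<Prod>I. F T m) = 0"
proof -
  obtain j where j: "j \<in> T" "j \<in> I" using T by blast
  obtain b where b: "\<psi> j b = -1" using psi_minus[OF j(2)] by blast
  have "\<exists>a. \<forall>q\<in>I. [a = (if q = j then b else 1)] (mod q)"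
    by (rule chinese_remainder_nat[OF finite_I]) (simp add: coprime_I)
  then obtain a where a: "\<And>q. q \<in> I \<Longrightarrow> [a = (if q = j then b else 1)] (mod q)" by blast
  have psi_a: "\<psi> q a = (if q = j then -1 else 1)" if "q \<in> I" for q
    using psi_cong[OF that a[OF that]] b psi_1[OF that] by auto
  have "F T a = (\<Prod>q\<in>I. if q = j then -1 else 1)"
    unfolding F_def using j by (intro prod.cong) (auto simp: psi_a)
  then have Fa: "F T a = -1" using finite_I j(2) by simp
  have "coprime a (\<Prod>I)"
  proof (rule prod_coprime_right)
    show "coprime a q" if "q \<in> I" for q using psi_zero[OF that, of a] psi_a[OF that] by (auto split: if_splits)
  qed
  let ?M = "\<Prod>I"
  have "inj_on (\<lambda>m. a * m mod ?M) {..<?M}"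
  proof (rule inj_onI)
    fix x y assume xy: "x \<in> {..<?M}" "y \<in> {..<?M}" "a * x mod ?M = a * y mod ?M"
    then have "[a * x = a * y] (mod ?M)" by (simp add: cong_def)
    then have "[x = y] (mod ?M)" using \<open>coprime a ?M\<close> by (simp add: cong_mult_lcancel_nat)
    then show "x = y" using xy by (simp add: cong_def)
  qed
  moreover have "(\<lambda>m. a * m mod ?M) ` {..<?M} \<subseteq> {..<?M}" using modulus_pos by auto
  ultimately have bij: "bij_betw (\<lambda>m. a * m mod ?M) {..<?M} {..<?M}"
    by (simp add: bij_betw_def endo_inj_surj)
  have "(\<Sum>m<?M. F T m) = (\<Sum>m<?M. F T (a * m mod ?M))"
    using sum.reindex_bij_betw[OF bij, of "F T"] by simp
  also have "\<dots> = (\<Sum>m<?M. F T (a * m))"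
    by (intro sum.cong refl F_cong) (simp add: cong_def)
  also have "\<dots> = - (\<Sum>m<?M. F T m)" by (simp add: F_mult Fa sum_negf)
  finally show ?thesis by simp
qed

section \<open>Existence of a modulus with prescribed character values\<close>

definition r :: "nat \<Rightarrow> int" where "r m = (\<Sum>d | d dvd m. F I d)"

text \<open>For \<open>m = d * e\<close> the term \<open>F T m * F I d\<close> equals
  \<open>F (I - T) d * F T e\<close>. As neither \<open>T\<close> nor its complement is empty, both
  factors sum to 0 over a period.\<close>

lemma F_r_abel_bounded:
  assumes T: "T \<subseteq> I" "T \<noteq> {}" "T \<noteq> I"
  shows "abel_bounded (\<lambda>m. real_of_int (F T m * r m))"
proof -
  let ?M = "\<Prod>I"
  have per: "F T (?M + n) = F T n" for T n by (rule F_cong) (simp add: cong_def)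
  have sum0: "(\<Sum>m<?M. real_of_int (F T m)) = 0" if "T \<inter> I \<noteq> {}" for T
    using F_sum_zero[OF that] by (metis of_int_0 of_int_sum)
  have "abel_bounded (\<lambda>m. \<Sum>d | d dvd m. real_of_int (F (I - T) d) * real_of_int (F T (m div d)))"
    using T by (intro convolution_abel_bounded[OF modulus_pos] sum0) (auto simp: per F_zero)
  moreover have "real_of_int (F T m * r m) = (\<Sum>d | d dvd m. real_of_int (F (I - T) d) * real_of_int (F T (m div d)))"
    for m
  proof -
    have "F T m * r m = (\<Sum>d | d dvd m. F T m * F I d)" by (simp add: r_def sum_distrib_left)
    also have "\<dots> = (\<Sum>d | d dvd m. F (I - T) d * F T (m div d))"
    proof (rule sum.cong[OF refl])
      fix d assume "d \<in> {d. d dvd m}"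
      then have "m = d * (m div d)" by simp
      then have "F T m = F T d * F T (m div d)" by (metis F_mult)
      then show "F T m * F I d = F (I - T) d * F T (m div d)"
        by (simp add: F_complement[symmetric] mult_ac)
    qed
    finally show ?thesis by simp
  qed
  ultimately show ?thesis by simp
qed

lemma r_nonneg: "m > 0 \<Longrightarrow> r m \<ge> 0"
  and r_square: "m > 0 \<Longrightarrow> (\<And>p. prime p \<Longrightarrow> even (multiplicity p m)) \<Longrightarrow> r m \<ge> 1"
  and r_nonzero: "m > 0 \<Longrightarrow> r m \<noteq> 0 \<Longrightarrow> prime p \<Longrightarrow> odd (multiplicity p m) \<Longrightarrow> F I p \<noteq> -1"
  using divisor_sum_character[of "F I" m, OF F_mult F_1 F_vals] unfolding r_def by blast+

text \<open>For signs \<open>\<epsilon> q\<close>, the weights detect the pattern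
  \<open>\<psi> q m = \<epsilon> q\<close>. Expanded, they give the \<open>F T\<close> with
  \<open>T\<close> avoiding \<open>i0\<close>; against \<open>r\<close> every
  \<open>T \<noteq> {}\<close> is Abel-bounded, while \<open>T = {}\<close> diverges on squares.
  Leaving out \<open>i0\<close> keeps away \<open>T = I\<close>, to which
  \<open>F_r_abel_bounded\<close> does not apply.\<close>

lemma exists_weighted_nonzero:
  assumes i0: "i0 \<in> I"
  shows "\<exists>m>0. r m * F {} m * (\<Prod>q\<in>I - {i0}. \<epsilon> q * \<psi> q m + 1) \<noteq> 0"
proof (rule ccontr)
  assume "\<not> ?thesis"
  then have zero: "r m * F {} m * (\<Prod>q\<in>I - {i0}. \<epsilon> q * \<psi> q m + 1) = 0" if "m > 0" for m
    using that by blast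
  let ?J = "I - {i0}"
  have finJ: "finite ?J" using finite_I by simp
  have expand: "F {} m * (\<Prod>q\<in>?J. \<epsilon> q * \<psi> q m + 1) = (\<Sum>T\<in>Pow ?J. (\<Prod>q\<in>T. \<epsilon> q) * F T m)" for m
  proof -
    have "F {} m * (\<Prod>q\<in>?J. \<epsilon> q * \<psi> q m + 1)
        = (\<Sum>T\<in>Pow ?J. F {} m * ((\<Prod>q\<in>T. \<epsilon> q) * (\<Prod>q\<in>T. \<psi> q m)))"
      by (simp add: prod_add[OF finJ] prod.distrib sum_distrib_left)
    also have "\<dots> = (\<Sum>T\<in>Pow ?J. (\<Prod>q\<in>T. \<epsilon> q) * F T m)"
    proof (rule sum.cong[OF refl])
      fix T assume "T \<in> Pow ?J"
      then have T: "T \<subseteq> I" by auto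
      have "(\<Prod>q\<in>T. \<psi> q m) = (\<Prod>q\<in>I. if q \<in> T then \<psi> q m else 1)"
        using T finite_I by (simp add: prod.inter_restrict[symmetric] Int_absorb1)
      then have "F {} m * (\<Prod>q\<in>T. \<psi> q m) = (\<Prod>q\<in>I. (\<psi> q m)\<^sup>2 * (if q \<in> T then \<psi> q m else 1))"
        by (simp add: F_def prod.distrib)
      also have "\<dots> = F T m"
        unfolding F_def
      proof (rule prod.cong[OF refl])
        fix q assume "q \<in> I"
        then show "(\<psi> q m)\<^sup>2 * (if q \<in> T then \<psi> q m else 1) = (if q \<in> T then \<psi> q m else (\<psi> q m)\<^sup>2)"
          using psi_vals[of q m] by auto
      qed
      finally show "F {} m * ((\<Prod>q\<in>T. \<epsilon> q) * (\<Prod>q\<in>T. \<psi> q m)) = (\<Prod>q\<in>T. \<epsilon> q) * F T m"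
        by (simp add: mult_ac)
    qed
    finally show ?thesis .
  qed
  \<comment> \<open>If all weighted terms vanish, the principal term is minus the sum of the others
    and thus Abel-bounded.\<close>
  have "F {} m * r m = (\<Sum>T\<in>Pow ?J - {{}}. - (\<Prod>q\<in>T. \<epsilon> q) * (F T m * r m))" if "m \<ge> 1" for m
  proof -
    have "0 = (\<Sum>T\<in>Pow ?J. (\<Prod>q\<in>T. \<epsilon> q) * F T m) * r m"
      using zero[of m] that expand[of m] by (simp add: mult_ac)
    also have "\<dots> = F {} m * r m + (\<Sum>T\<in>Pow ?J - {{}}. (\<Prod>q\<in>T. \<epsilon> q) * (F T m * r m))"
      using finJ by (subst sum.remove[of _ "{}"]) (auto simp: sum_distrib_left sum_distrib_right algebra_simps)
    finally show ?thesis by (simp add: sum_negf)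
  qed
  then have eq: "real_of_int (F {} m * r m)
      = (\<Sum>T\<in>Pow ?J - {{}}. real_of_int (- (\<Prod>q\<in>T. \<epsilon> q)) * real_of_int (F T m * r m))" if "m \<ge> 1" for m
    using that by simp
  have "abel_bounded (\<lambda>m. \<Sum>T\<in>Pow ?J - {{}}. real_of_int (- (\<Prod>q\<in>T. \<epsilon> q)) * real_of_int (F T m * r m))"
    using finJ i0 by (intro abel_bounded_sum abel_bounded_cmult F_r_abel_bounded) auto
  then have ab: "abel_bounded (\<lambda>m. real_of_int (F {} m * r m))"
    using abel_bounded_cong[OF eq] by simp
  have F0: "F {} m \<ge> 0" for m unfolding F_def by (intro prod_nonneg) auto
  have nonneg: "real_of_int (F {} m * r m) \<ge> 0" if "m \<ge> 1" for m
    using F0[of m] r_nonneg[of m] that by simp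
  obtain C where C: "\<And>n. (\<Sum>m=1..n. real_of_int (F {} m * r m)) \<le> C"
    using abel_bounded_nonneg_partial_sums[OF ab nonneg] by blast
  \<comment> \<open>Squares of numbers that are 1 modulo \<open>\<Prod>I\<close>: there
    \<open>F {}\<close> is 1 and \<open>r\<close> is at least 1.\<close>
  define s where "s = (\<lambda>j. (1 + j * \<Prod>I)\<^sup>2)"
  have s_inj: "inj_on s {..<n}" for n
    using modulus_pos by (auto simp: s_def inj_on_def power2_eq_iff_nonneg)
  have s_ge: "real_of_int (F {} (s j) * r (s j)) \<ge> 1" for j
  proof -
    have "F {} (1 + j * \<Prod>I) = F {} 1"
      by (rule F_cong) (simp only: cong_def mod_mult_self1)
    then have "F {} (s j) = 1" unfolding s_def power2_eq_square F_mult using F_1 by simp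
    moreover have "r (s j) \<ge> 1"
    proof (rule r_square)
      show "s j > 0" by (simp add: s_def)
      show "even (multiplicity p (s j))" if "prime p" for p
        using that by (simp add: s_def prime_elem_multiplicity_power_distrib)
    qed
    ultimately show ?thesis by simp
  qed
  have "real n \<le> C" for n
  proof -
    define N where "N = (\<Sum>j<n. s j)"
    have "s ` {..<n} \<subseteq> {1..N}"
      using member_le_sum[of _ "{..<n}" s] by (auto simp: N_def s_def)
    then have "(\<Sum>m\<in>s ` {..<n}. real_of_int (F {} m * r m)) \<le> (\<Sum>m=1..N. real_of_int (F {} m * r m))"
      by (intro sum_mono2 nonneg) auto
    also have "\<dots> \<le> C" by (rule C)
    finally have "(\<Sum>j<n. real_of_int (F {} (s j) * r (s j))) \<le> C"
      by (simp add: sum.reindex[OF s_inj] o_def)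
    moreover have "(\<Sum>j<n. 1) \<le> (\<Sum>j<n. real_of_int (F {} (s j) * r (s j)))"
      by (intro sum_mono s_ge)
    ultimately show ?thesis by simp
  qed
  then show False using reals_Archimedean2[of C] by (meson not_le)
qed

text \<open>A nonzero weighted term at \<open>m\<close> fixes the signs. The squarefree part of
  \<open>m\<close> has the same character values, and its primes have odd multiplicity in
  \<open>m\<close>, so that \<open>r m \<noteq> 0\<close> excludes
  \<open>F I p = -1\<close>.\<close>

theorem exists_prescribed_values:
  assumes i0: "i0 \<in> I" and eps: "\<And>q. q \<in> I \<Longrightarrow> \<epsilon> q \<in> {-1, 1}"
  shows "\<exists>k>0. squarefree k \<and> (\<forall>q\<in>I - {i0}. \<psi> q k = \<epsilon> q) \<and> (\<forall>p. prime p \<longrightarrow> p dvd k \<longrightarrow> F I p = 1)"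
proof -
  obtain m where m: "m > 0" "r m * F {} m * (\<Prod>q\<in>I - {i0}. \<epsilon> q * \<psi> q m + 1) \<noteq> 0"
    using exists_weighted_nonzero[OF i0] by blast
  then have rm: "r m \<noteq> 0" and Fm: "F {} m \<noteq> 0" and prod: "\<And>q. q \<in> I - {i0} \<Longrightarrow> \<epsilon> q * \<psi> q m + 1 \<noteq> 0"
    using finite_I by (auto simp: prod_zero_iff)
  define k t :: nat where "k = squarefree_part m" and "t = square_part m"
  have mk: "m = k * t\<^sup>2" unfolding k_def t_def by (rule squarefree_decompose)
  have nz: "\<psi> q m \<noteq> 0" if "q \<in> I" for q using Fm that by (auto simp: F_zero_iff)
  have psik: "\<psi> q k = \<psi> q m" if "q \<in> I" for q
  proof -
    have "\<psi> q m = \<psi> q k * (\<psi> q t)\<^sup>2" by (simp add: mk psi_mult[OF that] power2_eq_square)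
    then show ?thesis using nz[OF that] psi_vals[OF that, of t] by auto
  qed
  have "\<psi> q k = \<epsilon> q" if "q \<in> I - {i0}" for q
    using psi_vals[of q m] nz[of q] psik[of q] prod[OF that] eps[of q] that by auto
  moreover have "F I p = 1" if p: "prime p" "p dvd k" for p
  proof -
    have "multiplicity p k > 0" using p by (simp add: prime_multiplicity_gt_zero_iff k_def)
    then have "odd (multiplicity p m)"
      unfolding k_def prime_multiplicity_squarefree_part[OF p(1)] by presburger
    then have "F I p \<noteq> -1" using r_nonzero[OF m(1) rm p(1)] by simp
    moreover have "F I p \<noteq> 0"
    proof
      assume "F I p = 0"
      then obtain q where q: "q \<in> I" "\<psi> q p = 0" by (auto simp: F_zero_iff)
      obtain c where "k = p * c" using p(2) by blast
      then have "\<psi> q k = 0" using q by (simp add: psi_mult)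
      then show False using psik[OF q(1)] nz[OF q(1)] by simp
    qed
    ultimately show ?thesis using F_vals[of I p] by auto
  qed
  moreover have "k > 0" using m(1) mk by (cases "k = 0") simp_all
  moreover have "squarefree k" by (simp add: k_def)
  ultimately show ?thesis by blast
qed

text \<open>Serves to recover the character at the omitted modulus from the product of all of
  them.\<close>

lemma F_eq_1_of_primes:
  assumes "k > 0" "\<And>p. prime p \<Longrightarrow> p dvd k \<Longrightarrow> F I p = 1"
  shows "F I k = 1"
  using assms
proof (induction k rule: prime_divisors_induct)
  case (factor p k)
  then show ?case by (simp add: F_mult)
qed (simp_all add: F_1[simplified])

end

section \<open>Moduli with prescribed Legendre symbols\<close>

definition chi4 :: "nat \<Rightarrow> int" where
  "chi4 a = (if a mod 4 = 1 then 1 else if a mod 4 = 3 then -1 else 0)"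

lemma chi4_mult: "chi4 (a * b) = chi4 a * chi4 b"
proof -
  have "a mod 4 = 0 \<or> a mod 4 = 1 \<or> a mod 4 = 2 \<or> a mod 4 = 3"
    "b mod 4 = 0 \<or> b mod 4 = 1 \<or> b mod 4 = 2 \<or> b mod 4 = 3" by presburger+
  moreover have "(a * b) mod 4 = ((a mod 4) * (b mod 4)) mod 4" by (simp add: mod_mult_eq)
  ultimately show ?thesis unfolding chi4_def by (elim disjE) simp_all
qed

lemma chi4_eq_power:
  assumes "odd a"
  shows "chi4 a = (-1) ^ ((a - 1) div 2)"
proof -
  obtain c where c: "a = 2 * c + 1" using assms by (rule oddE)
  show ?thesis
  proof (cases "even c")
    case True
    then obtain d where "c = 2 * d" by (rule evenE)
    then have "a mod 4 = 1" using c by simp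
    then show ?thesis using True c by (simp add: chi4_def)
  next
    case False
    then obtain d where "c = 2 * d + 1" by (rule oddE)
    then have "a = 4 * d + 3" using c by simp
    then have "a mod 4 = 3" by simp
    then show ?thesis using False c by (simp add: chi4_def)
  qed
qed

lemma Legendre_cong: "[a = b] (mod p) \<Longrightarrow> Legendre a p = Legendre b p"
proof -
  assume ab: "[a = b] (mod p)"
  then have "[a = 0] (mod p) \<longleftrightarrow> [b = 0] (mod p)" and "QuadRes p a \<longleftrightarrow> QuadRes p b"
    unfolding QuadRes_def by (meson cong_trans cong_sym)+
  then show ?thesis by (simp add: Legendre_def)
qed

lemma Legendre_vals: "Legendre a p \<in> {-1, 0, 1}"
  by (simp add: Legendre_def)

lemma Legendre_zero_iff: "Legendre a p = 0 \<longleftrightarrow> p dvd a"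
  by (simp add: Legendre_def cong_0_iff)

lemma Legendre_eq_1D: "Legendre a p = 1 \<Longrightarrow> \<exists>y. p dvd y\<^sup>2 - a"
  by (auto simp: Legendre_def QuadRes_def cong_iff_dvd_diff split: if_splits)

lemma cong_imp_eq_signs:
  fixes x y p :: int
  assumes "[x = y] (mod p)" "p > 2" "x \<in> {-1, 0, 1}" "y \<in> {-1, 0, 1}"
  shows "x = y"
proof -
  have "p dvd x - y" using assms by (simp add: cong_iff_dvd_diff)
  moreover have "\<bar>x - y\<bar> < p" using assms by auto
  ultimately show ?thesis using dvd_imp_le_int[of "x - y" p] by linarith
qed

text \<open>Euler's criterion; as \<open>p > 2\<close>, values in -1, 0, 1 that are congruent modulo
  \<open>p\<close> coincide.\<close>

lemma Legendre_eq_power: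
  assumes "prime p" "p > 2" "[x = a ^ ((p - 1) div 2)] (mod int p)" "x \<in> {-1, 0, 1}"
  shows "Legendre a (int p) = x"
  using assms Legendre_vals[of a "int p"]
  by (intro cong_imp_eq_signs[of _ _ "int p"] cong_trans[OF euler_criterion cong_sym]) auto

lemma Legendre_mult:
  assumes "prime p" "p > 2"
  shows "Legendre (a * b) (int p) = Legendre a (int p) * Legendre b (int p)"
proof (rule Legendre_eq_power[OF assms])
  show "[Legendre a (int p) * Legendre b (int p) = (a * b) ^ ((p - 1) div 2)] (mod int p)"
    unfolding power_mult_distrib by (intro cong_mult euler_criterion assms)
  show "Legendre a (int p) * Legendre b (int p) \<in> {-1, 0, 1}"
    using Legendre_vals[of a "int p"] Legendre_vals[of b "int p"] by auto
qed

lemma Legendre_prod: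
  assumes "prime p" "p > 2" "finite A"
  shows "Legendre (\<Prod>a\<in>A. g a) (int p) = (\<Prod>a\<in>A. Legendre (g a) (int p))"
  using assms(3)
proof (induction rule: finite_induct)
  case empty
  show ?case using assms by (auto intro!: Legendre_eq_power)
next
  case (insert a A)
  then show ?case by (simp add: Legendre_mult assms)
qed

lemma Legendre_minus_1:
  assumes "prime p" "p > 2"
  shows "Legendre (-1) (int p) = chi4 p"
proof (rule Legendre_eq_power[OF assms])
  have "odd p" using assms prime_odd_nat by blast
  then show "[chi4 p = (-1) ^ ((p - 1) div 2)] (mod int p)" by (simp add: chi4_eq_power)
  show "chi4 p \<in> {-1, 0, 1}" by (simp add: chi4_def)
qed

lemma Legendre_3: "Legendre a 3 = (if a mod 3 = 0 then 0 else if a mod 3 = 1 then 1 else -1)"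
proof -
  have "a mod 3 = 0 \<or> a mod 3 = 1 \<or> a mod 3 = 2" by presburger
  then consider "a mod 3 = 0" | "a mod 3 = 1" | "a mod 3 = 2" by (elim disjE)
  then show ?thesis
  proof cases
    case 1
    then show ?thesis by (simp add: Legendre_zero_iff dvd_eq_mod_eq_0)
  next
    case 2
    then have "[1\<^sup>2 = a] (mod 3)" by (simp add: cong_def)
    then have "QuadRes 3 a" unfolding QuadRes_def by blast
    then show ?thesis using 2 by (simp add: Legendre_def cong_def)
  next
    case 3
    have "\<not> QuadRes 3 a"
    proof
      assume "QuadRes 3 a"
      then obtain y where "[y\<^sup>2 = a] (mod 3)" by (auto simp: QuadRes_def)
      then have "3 dvd y\<^sup>2 - a" by (simp add: cong_iff_dvd_diff)
      moreover have "3 dvd a + 1" using 3 by presburger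
      ultimately have "3 dvd (y\<^sup>2 - a) + (a + 1)" by (rule dvd_add)
      then show False using three_sum_two_squares_nonzero[of y] by simp
    qed
    then show ?thesis using 3 by (simp add: Legendre_def cong_def)
  qed
qed

text \<open>Otherwise squaring would be onto, hence injective, on the residues; but 1 and
  \<open>p - 1\<close> have the same square.\<close>

lemma exists_nonresidue:
  assumes "prime p" "p > 2"
  shows "\<exists>a::nat. Legendre (int a) (int p) = -1"
proof (rule ccontr)
  assume no: "\<not> ?thesis"
  define sq where "sq = (\<lambda>x::nat. x\<^sup>2 mod p)"
  have "{..<p} \<subseteq> sq ` {..<p}"
  proof
    fix a assume a: "a \<in> {..<p}"
    show "a \<in> sq ` {..<p}"
    proof (cases "a = 0")
      case True
      then show ?thesis using assms by (auto simp: sq_def intro!: image_eqI[of _ _ 0])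
    next
      case False
      then have "\<not> int p dvd int a" using a by (auto dest: dvd_imp_le)
      then have "Legendre (int a) (int p) = 1"
        using no Legendre_vals[of "int a" "int p"] Legendre_zero_iff[of "int a" "int p"] by auto
      then obtain y where y: "int p dvd y\<^sup>2 - int a" using Legendre_eq_1D by blast
      define x where "x = nat (y mod int p)"
      have x: "int x = y mod int p" using assms by (simp add: x_def)
      have "int (sq x) = (int x)\<^sup>2 mod int p" by (simp add: sq_def of_nat_mod)
      also have "\<dots> = y\<^sup>2 mod int p" by (simp add: x power_mod)
      also have "\<dots> = int a mod int p" using y by (simp add: mod_eq_dvd_iff)
      finally have "sq x = a" using a by (simp add: of_nat_mod[symmetric])
      moreover have "int x < int p" unfolding x using assms by (intro pos_mod_bound) simp
      ultimately show ?thesis by auto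
    qed
  qed
  then have "inj_on sq {..<p}"
    by (intro eq_card_imp_inj_on finite_lessThan antisym card_image_le card_mono[THEN order_trans, OF _ _ order_refl])
       (auto intro: card_mono)
  moreover have "sq 1 = sq (p - 1)"
  proof -
    obtain c where c: "p = 2 + c" using assms(2) less_imp_add_positive by blast
    have "(p - 1)\<^sup>2 = 1 + p * c" unfolding c by (simp add: power2_eq_square)
    then show ?thesis by (simp only: sq_def power_one mod_mult_self2)
  qed
  ultimately have "1 = p - 1" using assms by (auto simp: inj_on_def)
  then show False using assms by simp
qed

section \<open>Squarefree moduli and reciprocity\<close>

lemma squarefree_prod_prime_factors:
  fixes n :: nat
  assumes "squarefree n"
  shows "\<Prod>(prime_factors n) = n"
proof -
  have "n \<noteq> 0" using assms by (auto intro: ccontr)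
  have "(\<Prod>p\<in>prime_factors n. p ^ multiplicity p n) = n" using \<open>n \<noteq> 0\<close> by (simp add: prod_prime_factors)
  moreover have "p ^ multiplicity p n = p" if "p \<in> prime_factors n" for p
  proof -
    have "multiplicity p n = 1"
      using that assms \<open>n \<noteq> 0\<close> by (simp add: squarefree_factorial_semiring')
    then show ?thesis by simp
  qed
  ultimately show ?thesis by simp
qed

text \<open>Local solutions are glued by the Chinese remainder theorem; the distinct primes then
  divide one common value, and so does their product \<open>n\<close>.\<close>

lemma squarefree_dvd_quadratic:
  fixes n :: nat and A C :: int
  assumes "squarefree n" and loc: "\<And>p. prime p \<Longrightarrow> p dvd n \<Longrightarrow> \<exists>x. int p dvd A * x\<^sup>2 + C"
  shows "\<exists>x. int n dvd A * x\<^sup>2 + C"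
proof -
  have n0: "n \<noteq> 0" using assms by (auto intro: ccontr)
  have "\<exists>u::nat. int p dvd A * (int u)\<^sup>2 + C" if p: "p \<in> prime_factors n" for p
  proof -
    have pp: "prime p" "p dvd n" using p by auto
    obtain x where x: "int p dvd A * x\<^sup>2 + C" using loc[OF pp] by blast
    define u where "u = nat (x mod int p)"
    have "int u = x mod int p" using pp by (simp add: u_def prime_gt_0_nat)
    then have "[int u = x] (mod int p)" by (simp add: cong_def)
    then have "[A * (int u)\<^sup>2 + C = A * x\<^sup>2 + C] (mod int p)"
      by (intro cong_add cong_mult cong_pow cong_refl)
    then show ?thesis using x cong_dvd_iff by blast
  qed
  then obtain u where u: "\<And>p. p \<in> prime_factors n \<Longrightarrow> int p dvd A * (int (u p))\<^sup>2 + C" by metis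
  have "\<exists>x. \<forall>p\<in>prime_factors n. [x = u p] (mod p)"
    by (rule chinese_remainder_nat) (auto intro: primes_coprime)
  then obtain x where x: "\<And>p. p \<in> prime_factors n \<Longrightarrow> [x = u p] (mod p)" by blast
  define Y where "Y = nat \<bar>A * (int x)\<^sup>2 + C\<bar>"
  have dvd_Y: "p dvd Y" if p: "p \<in> prime_factors n" for p
  proof -
    have "[int x = int (u p)] (mod int p)" using x[OF p] by (simp add: cong_int_iff)
    then have "[A * (int x)\<^sup>2 + C = A * (int (u p))\<^sup>2 + C] (mod int p)"
      by (intro cong_add cong_mult cong_pow cong_refl)
    then have "int p dvd A * (int x)\<^sup>2 + C" using u[OF p] cong_dvd_iff by blast
    then show ?thesis by (simp add: Y_def nat_dvd_iff int_dvd_int_iff[symmetric] del: int_dvd_int_iff)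
  qed
  have "\<Prod>A dvd Y" if "A \<subseteq> prime_factors n" for A
    using finite_subset[OF that finite_set_mset] that
  proof (induction A rule: finite_induct)
    case (insert p A)
    then have "coprime p (\<Prod>A)" by (intro prod_coprime_right primes_coprime) auto
    then show ?case using insert dvd_Y by (simp add: divides_mult)
  qed simp
  then have "\<Prod>(prime_factors n) dvd Y" by blast
  then have "int n dvd int Y" using squarefree_prod_prime_factors[OF assms(1)] by simp
  then have "int n dvd A * (int x)\<^sup>2 + C" by (simp add: Y_def)
  then show ?thesis by blast
qed

text \<open>Reciprocity is applied to each prime of \<open>D\<close>. For \<open>p\<close> 1 modulo
  4 no sign changes; otherwise the signs multiply to \<open>chi4 D\<close>, which cancels
  \<open>Legendre (-1) p\<close> when \<open>D\<close> is 3 modulo 4.\<close>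

lemma Legendre_minus_squarefree:
  assumes p: "prime p" "p > 2" and D: "odd D" "squarefree D" "\<not> p dvd D"
  shows "Legendre (- int D) (int p)
    = (if D mod 4 = 1 then chi4 p else 1) * (\<Prod>q\<in>prime_factors D. Legendre (int p) (int q))"
proof -
  have D_prod: "(\<Prod>q\<in>prime_factors D. q) = D" using squarefree_prod_prime_factors[OF D(2)] by simp
  have oddp: "odd p" using p prime_odd_nat by blast
  have chi4p: "chi4 p = 1 \<or> chi4 p = -1" using oddp by (simp add: chi4_eq_power minus_one_power_iff)
  have q: "prime q" "odd q" "q > 2" "q \<noteq> p" if "q \<in> prime_factors D" for q
  proof -
    have "q dvd D" "prime q" using that by auto
    then show "prime q" "odd q" "q \<noteq> p" using D by (auto intro: dvd_trans)
    then show "q > 2" using prime_ge_2_nat[of q] by (cases "q = 2") auto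
  qed
  have flip: "Legendre (int q) (int p) = Legendre (int p) (int q) * (if chi4 p = 1 then 1 else chi4 q)"
    if "q \<in> prime_factors D" for q
  proof -
    have sq: "Legendre (int p) (int q) * Legendre (int p) (int q) = 1"
      using Legendre_vals[of "int p" "int q"] Legendre_zero_iff[of "int p" "int q"] q[OF that] p(1)
      by (auto simp: primes_dvd_imp_eq)
    have "Legendre (int p) (int q) * Legendre (int q) (int p)
        = (-1) ^ ((p - 1) div 2 * ((q - 1) div 2))"
      using q[OF that] p by (intro Quadratic_Reciprocity) auto
    also have "\<dots> = (if chi4 p = 1 then 1 else chi4 q)"
      unfolding power_mult chi4_eq_power[OF oddp, symmetric]
      using chi4p q(2)[OF that] by (auto simp: chi4_eq_power)
    finally have "Legendre (int p) (int q) * (Legendre (int p) (int q) * Legendre (int q) (int p))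
        = Legendre (int p) (int q) * (if chi4 p = 1 then 1 else chi4 q)" by simp
    then show ?thesis using sq by (simp add: mult.assoc[symmetric])
  qed
  have chi4_D: "(\<Prod>q\<in>prime_factors D. chi4 q) = chi4 D"
  proof -
    have "(\<Prod>q\<in>A. chi4 q) = chi4 (\<Prod>q\<in>A. q)" if "finite A" for A
      using that by (induction rule: finite_induct) (simp_all add: chi4_mult, simp add: chi4_def)
    then show ?thesis using D_prod by simp
  qed
  have "Legendre (- int D) (int p) = Legendre (-1) (int p) * Legendre (\<Prod>q\<in>prime_factors D. int q) (int p)"
    unfolding Legendre_mult[OF p, symmetric] by (subst (1) D_prod[symmetric]) simp
  also have "\<dots> = chi4 p * (\<Prod>q\<in>prime_factors D. Legendre (int q) (int p))"
    by (simp add: Legendre_minus_1 Legendre_prod p)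
  also have "\<dots> = chi4 p * ((\<Prod>q\<in>prime_factors D. Legendre (int p) (int q)) *
      (\<Prod>q\<in>prime_factors D. if chi4 p = 1 then 1 else chi4 q))"
    by (simp add: flip prod.distrib cong: prod.cong)
  also have "(\<Prod>q\<in>prime_factors D. if chi4 p = 1 then 1 else chi4 q) = (if chi4 p = 1 then 1 else chi4 D)"
    using chi4_D by simp
  finally show ?thesis
  proof -
    assume *: "Legendre (- int D) (int p) = chi4 p * ((\<Prod>q\<in>prime_factors D. Legendre (int p) (int q)) *
      (if chi4 p = 1 then 1 else chi4 D))"
    have "D mod 4 = 1 \<or> D mod 4 = 3" using D(1) by presburger
    then show ?thesis using * chi4p by (auto simp: chi4_def[of D])
  qed
qed

text \<open>The moduli are the primes dividing \<open>D\<close>, and 4 if \<open>D mod 4 = 1\<close>; by reciprocity the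
  product of all the characters at an odd prime \<open>p\<close> is the Legendre symbol of \<open>- D\<close>.\<close>

lemma exists_square_modulus:
  fixes D :: nat and \<epsilon> :: "nat \<Rightarrow> int"
  assumes D: "odd D" "squarefree D"
    and eps: "\<And>p. p \<in> prime_factors D \<Longrightarrow> \<epsilon> p \<in> {-1, 1}"
    and consistent: "D mod 4 = 3 \<Longrightarrow> (\<Prod>p\<in>prime_factors D. \<epsilon> p) = 1"
  shows "\<exists>k>0. (\<forall>p\<in>prime_factors D. Legendre (int k) (int p) = \<epsilon> p) \<and> (\<exists>x. int k dvd x\<^sup>2 + int D)"
proof -
  define I where "I = prime_factors D \<union> (if D mod 4 = 1 then {4} else {})"
  define \<psi> where "\<psi> = (\<lambda>q a. if q = 4 then chi4 a else Legendre (int a) (int q))"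
  have four: "4 \<notin> prime_factors D"
  proof
    assume "4 \<in> prime_factors D"
    then have "prime (4::nat)" by blast
    then show False using prime_odd_nat[of 4] by simp
  qed
  have D0: "D > 0" using D(1) by (rule odd_pos)
  have D13: "D mod 4 = 1 \<or> D mod 4 = 3" using D(1) by presburger
  have pf: "prime q" "q > 2" "odd q" "q \<noteq> 4" if "q \<in> prime_factors D" for q
  proof -
    have "q dvd D" "prime q" using that by auto
    then show "prime q" "odd q" using D by (auto intro: dvd_trans)
    then show "q > 2" using prime_ge_2_nat[of q] by (cases "q = 2") auto
    show "q \<noteq> 4" using that four by blast
  qed
  have I_cases: "q = 4 \<or> q \<in> prime_factors D" if "q \<in> I" for q
    using that by (auto simp: I_def split: if_splits)
  interpret quadratic_characters I \<psi>
  proof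
    show "finite I" by (simp add: I_def)
    \<comment> \<open>If \<open>D\<close> is 1 modulo 4, the modulus 4 is present, which covers
      \<open>D = 1\<close>; otherwise \<open>D\<close> has a prime divisor.\<close>
    show "I \<noteq> {}"
    proof (cases "D mod 4 = 1")
      case False
      then have "D \<noteq> 1" by auto
      then obtain p where "prime p" "p dvd D" using prime_factor_nat by blast
      then have "p \<in> prime_factors D" using D0 by (auto simp: in_prime_factors_iff)
      then show ?thesis by (auto simp: I_def)
    qed (simp add: I_def)
    have odd4: "coprime q 4" "coprime 4 q" if "odd q" for q :: nat
      using that coprime_power_right_iff[of q 2 2] by (auto simp: coprime_commute)
    show "coprime q r" if "q \<in> I" "r \<in> I" "q \<noteq> r" for q r
      using I_cases[OF that(1)] I_cases[OF that(2)] that(3) pf odd4 by (metis primes_coprime)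
    show "q > 1" if "q \<in> I" for q using I_cases[OF that] pf[of q] by auto
    show "\<psi> q (a * b) = \<psi> q a * \<psi> q b" if "q \<in> I" for q a b
      using I_cases[OF that] pf[of q] by (auto simp: \<psi>_def chi4_mult Legendre_mult)
    show "\<psi> q a = \<psi> q b" if "q \<in> I" "[a = b] (mod q)" for q a b
    proof (cases "q = 4")
      case True
      then show ?thesis using that by (simp add: \<psi>_def chi4_def cong_def)
    next
      case False
      then show ?thesis using that by (simp add: \<psi>_def cong_int_iff Legendre_cong)
    qed
    show "\<psi> q a = 0 \<longleftrightarrow> \<not> coprime a q" if "q \<in> I" for q a
    proof (cases "q = 4")
      case True
      have "chi4 a = 0 \<longleftrightarrow> even a" unfolding chi4_def by simp presburger
      moreover have "coprime a 4 \<longleftrightarrow> odd a"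
        using odd4[of a] coprime_common_divisor_nat[of a 4 2] by auto
      ultimately show ?thesis using True by (simp add: \<psi>_def)
    next
      case False
      then have q: "prime q" using I_cases[OF that] pf by blast
      have "\<not> coprime a q \<longleftrightarrow> q dvd a"
        using q prime_imp_coprime[of q a] coprime_common_divisor_nat[of a q q] 
        by (auto simp: coprime_commute)
      then show ?thesis using False by (simp add: \<psi>_def Legendre_zero_iff)
    qed
    show "\<psi> q a \<in> {-1, 0, 1}" for q a
      using Legendre_vals[of "int a" "int q"] by (simp add: \<psi>_def chi4_def)
    show "\<exists>a. \<psi> q a = -1" if "q \<in> I" for q
    proof (cases "q = 4")
      case True
      then show ?thesis by (intro exI[of _ 3]) (simp add: \<psi>_def chi4_def)
    next
      case False
      then show ?thesis using I_cases[OF that] pf exists_nonresidue[of q] by (simp add: \<psi>_def)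
    qed
  qed
  have F_prod: "F I m = (if D mod 4 = 1 then chi4 m else 1) * (\<Prod>q\<in>prime_factors D. Legendre (int m) (int q))" for m
  proof -
    have "F I m = (\<Prod>q\<in>I. \<psi> q m)" unfolding F_def by (intro prod.cong) auto
    also have "\<dots> = (\<Prod>q\<in>(if D mod 4 = 1 then {4} else {}). \<psi> q m) * (\<Prod>q\<in>prime_factors D. \<psi> q m)"
      unfolding I_def using four by (subst prod.union_disjoint) (auto simp: mult.commute)
    also have "(\<Prod>q\<in>prime_factors D. \<psi> q m) = (\<Prod>q\<in>prime_factors D. Legendre (int m) (int q))"
      using four by (intro prod.cong) (auto simp: \<psi>_def)
    finally show ?thesis by (simp add: \<psi>_def)
  qed
  \<comment> \<open>The character left free: 4 if present, where no value is prescribed; otherwise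
    some prime, whose symbol is then forced by \<open>F I k = 1\<close> and
    \<open>consistent\<close>.\<close>
  define i0 where "i0 = (if D mod 4 = 1 then 4 else SOME q. q \<in> I)"
  have i0: "i0 \<in> I" using nonempty some_in_eq[of I] by (auto simp: i0_def I_def)
  \<comment> \<open>The value at 4 is a mere default, since 4 is \<open>i0\<close> whenever it lies
    in \<open>I\<close>.\<close>
  define \<epsilon>' where "\<epsilon>' = (\<lambda>q. if q = 4 then 1 else \<epsilon> q)"
  have "\<epsilon>' q \<in> {-1, 1}" if "q \<in> I" for q using I_cases[OF that] eps by (auto simp: \<epsilon>'_def)
  then obtain k where k: "k > 0" "squarefree k" "\<And>q. q \<in> I - {i0} \<Longrightarrow> \<psi> q k = \<epsilon>' q"
      "\<And>p. prime p \<Longrightarrow> p dvd k \<Longrightarrow> F I p = 1"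
    using exists_prescribed_values[OF i0, of \<epsilon>'] by blast
  have most: "Legendre (int k) (int p) = \<epsilon> p" if "p \<in> prime_factors D" "p \<noteq> i0" for p
    using k(3)[of p] that pf(4)[OF that(1)] by (auto simp: I_def \<psi>_def \<epsilon>'_def)
  have all: "Legendre (int k) (int p) = \<epsilon> p" if p: "p \<in> prime_factors D" for p
  proof (cases "p = i0")
    case True
    then have D3: "D mod 4 = 3" using D13 four p by (auto simp: i0_def)
    have "F I k = 1" by (rule F_eq_1_of_primes[OF k(1,4)])
    then have "(\<Prod>q\<in>prime_factors D. Legendre (int k) (int q)) = (\<Prod>q\<in>prime_factors D. \<epsilon> q)"
      using D3 consistent by (simp add: F_prod)
    then have "Legendre (int k) (int p) * (\<Prod>q\<in>prime_factors D - {p}. Legendre (int k) (int q))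
        = \<epsilon> p * (\<Prod>q\<in>prime_factors D - {p}. \<epsilon> q)"
      using p by (simp add: prod.remove)
    moreover have "(\<Prod>q\<in>prime_factors D - {p}. Legendre (int k) (int q)) = (\<Prod>q\<in>prime_factors D - {p}. \<epsilon> q)"
      using True most by (intro prod.cong) auto
    moreover have "(\<Prod>q\<in>prime_factors D - {p}. \<epsilon> q) \<noteq> 0" using eps by (fastforce simp: prod_zero_iff)
    ultimately show ?thesis by simp
  qed (use most p in blast)
  \<comment> \<open>Prime by prime for the squarefree \<open>k\<close>: at 2 take
    \<open>x = 1\<close>, as \<open>D\<close> is odd; at odd \<open>p\<close> reciprocity turns
    \<open>F I p = 1\<close> into \<open>Legendre (- D) p = 1\<close>.\<close>
  have "\<exists>x. int k dvd 1 * x\<^sup>2 + int D"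
  proof (rule squarefree_dvd_quadratic[OF k(2)])
    fix p assume p: "prime p" "p dvd k"
    show "\<exists>x. int p dvd 1 * x\<^sup>2 + int D"
    proof (cases "p = 2")
      case True
      then show ?thesis using D(1) by (intro exI[of _ 1]) simp
    next
      case False
      then have p2: "p > 2" using p(1) prime_ge_2_nat[of p] by simp
      have F1: "F I p = 1" using k(4)[OF p] .
      have "\<not> p dvd D"
      proof
        assume "p dvd D"
        then have "p \<in> prime_factors D" using p(1) D0 by (auto simp: in_prime_factors_iff)
        then have "p \<in> I" "\<psi> p p = 0" using four by (auto simp: I_def \<psi>_def Legendre_zero_iff)
        then have "F I p = 0" unfolding F_zero_iff by blast
        then show False using F1 by simp
      qed
      then have "Legendre (- int D) (int p) = 1"
        using F1 by (simp add: Legendre_minus_squarefree[OF p(1) p2 D] F_prod)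
      then show ?thesis using Legendre_eq_1D[of "- int D" "int p"] by simp
    qed
  qed
  then show ?thesis using k(1) all by auto
qed

section \<open>Cauchy's lemma and the choice of the parameters\<close>

text \<open>Rests on \<open>6 a - b^2 = (6 w - b)^2 + (2 x - y - z)^2 + 3 (y - z)^2\<close>. The
  congruences make the linear system for \<open>x\<close>, \<open>y\<close>, \<open>z\<close>,
  \<open>w\<close> solvable in integers, and the bound on \<open>5 a\<close> excludes negative
  solutions.\<close>

lemma cauchy_lemma_1_1_1_3:
  fixes a b t s v :: int
  assumes b0: "b \<ge> 0" and a0: "a \<ge> 0" and eq: "6*a - b\<^sup>2 = t\<^sup>2 + s\<^sup>2 + 3 * v\<^sup>2"
    and t2: "even (t + b)" and s2: "even (s + v)"
    and t3: "3 dvd t + b" and s3: "3 dvd s + b"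
    and lt: "5 * a < b\<^sup>2 + 2 * b + 6"
  shows "\<exists>x y z w :: nat. a = (int x)\<^sup>2 + (int y)\<^sup>2 + (int z)\<^sup>2 + 3 * (int w)\<^sup>2
    \<and> b = int x + int y + int z + 3 * int w"
proof -
  have "6 dvd t + b" using t2 t3 by presburger
  then obtain w where w: "t + b = 6 * w" by blast
  obtain u where u: "s - v = 2 * u" using s2 by (metis evenE even_add even_diff)
  have "3 dvd b - 3 * w - u - 2 * v"
  proof -
    have "b - 3 * w - u - 2 * v = (s + b) - 3 * (w + u + v)" using u by simp
    then show ?thesis using s3 by (metis dvd_diff dvd_triv_left)
  qed
  then obtain z where z: "b - 3 * w - u - 2 * v = 3 * z" by blast
  define y x where "y = z + v" and "x = y + u"
  have b: "b = x + y + z + 3 * w" using z by (simp add: x_def y_def)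
  have tt: "t = 6 * w - b" and ss: "s = 2 * u + v" using w u by auto
  have uv: "u = x - y" "v = y - z" by (simp_all add: x_def y_def)
  have "6 * a = 6 * (x\<^sup>2 + y\<^sup>2 + z\<^sup>2 + 3 * w\<^sup>2)"
    using eq unfolding tt ss uv b by (simp add: power2_eq_square algebra_simps)
  then have a: "a = x\<^sup>2 + y\<^sup>2 + z\<^sup>2 + 3 * w\<^sup>2" by simp
  have nonneg: "p \<ge> 0" if p: "b = p + q + r + 3 * w" "a = p\<^sup>2 + q\<^sup>2 + r\<^sup>2 + 3 * w\<^sup>2" for p q r
  proof (rule ccontr)
    assume "\<not> p \<ge> 0"
    then have "p \<le> -1" by simp
    \<comment> \<open>Cauchy-Schwarz with weights 1, 1, 3, giving
      \<open>5 (a - p^2) \<ge> (b - p)^2\<close>; with \<open>p \<le> -1\<close> this makes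
      \<open>5 a\<close> at least \<open>b^2 + 2 b + 6\<close>.\<close>
    have "5 * (q\<^sup>2 + r\<^sup>2 + 3 * w\<^sup>2) - (q + r + 3 * w)\<^sup>2
        = (q - r)\<^sup>2 + 3 * (q - w)\<^sup>2 + 3 * (r - w)\<^sup>2"
      by (simp add: power2_eq_square algebra_simps)
    also have "\<dots> \<ge> 0" by simp
    finally have "5 * (a - p\<^sup>2) \<ge> (b - p)\<^sup>2" using p by (simp add: add.assoc)
    then have "5 * a \<ge> b\<^sup>2 + 2 * (b * (- p)) + 6 * (p * p)"
      by (simp add: power2_eq_square algebra_simps)
    moreover have "b * 1 \<le> b * (- p)" using b0 \<open>p \<le> -1\<close> by (intro mult_left_mono) auto
    moreover have "1 * 1 \<le> (- p) * (- p)" using \<open>p \<le> -1\<close> by (intro mult_mono) auto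
    ultimately show False using lt by simp
  qed
  have "x \<ge> 0" using nonneg[of x y z] a b by simp
  moreover have "y \<ge> 0" using nonneg[of y x z] a b by simp
  moreover have "z \<ge> 0" using nonneg[of z x y] a b by simp
  moreover have "w \<ge> 0"
  proof (rule ccontr)
    assume "\<not> w \<ge> 0"
    then have "w \<le> -1" by simp
    \<comment> \<open>The same with weights 1, 1, 1, now isolating \<open>w\<close>.\<close>
    have "3 * (x\<^sup>2 + y\<^sup>2 + z\<^sup>2) - (x + y + z)\<^sup>2 = (x - y)\<^sup>2 + (y - z)\<^sup>2 + (x - z)\<^sup>2"
      by (simp add: power2_eq_square algebra_simps)
    also have "\<dots> \<ge> 0" by simp
    finally have "3 * (a - 3 * w\<^sup>2) \<ge> (b - 3 * w)\<^sup>2" using a b by simp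
    then have "3 * a \<ge> b\<^sup>2 + 6 * (b * (- w)) + 18 * (w * w)"
      by (simp add: power2_eq_square algebra_simps)
    moreover have "b * 1 \<le> b * (- w)" using b0 \<open>w \<le> -1\<close> by (intro mult_left_mono) auto
    moreover have "1 * 1 \<le> (- w) * (- w)" using \<open>w \<le> -1\<close> by (intro mult_mono) auto
    ultimately show False using lt a0 b0 by simp
  qed
  ultimately have "a = (int (nat x))\<^sup>2 + (int (nat y))\<^sup>2 + (int (nat z))\<^sup>2 + 3 * (int (nat w))\<^sup>2"
    "b = int (nat x) + int (nat y) + int (nat z) + 3 * int (nat w)" using a b by auto
  then show ?thesis by blast
qed

section \<open>Size and residues of the parameter \<open>i\<close>\<close>

text \<open>As \<open>a\<close> is about \<open>2 q\<close> and \<open>b\<close> about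
  \<open>m i\<close>, the conditions place \<open>(m i)^2\<close> roughly between
  \<open>10 q\<close> and \<open>12 q\<close>; for \<open>q\<close> this large there is room for six
  consecutive \<open>i\<close>.\<close>

lemma window_exists:
  fixes m q r :: int
  assumes m: "m \<ge> 3" and q: "q \<ge> 924 * m\<^sup>2" and r: "0 \<le> r" "r < m"
  shows "\<exists>i0\<ge>0. \<forall>i. i0 \<le> i \<and> i < i0 + 6 \<longrightarrow>
    (let b = r + m * i; a = b + 2 * (q - i)
     in a \<ge> 0 \<and> b \<ge> 0 \<and> b\<^sup>2 < 6 * a \<and> 5 * a < b\<^sup>2 + 2 * b + 6)"
proof -
  \<comment> \<open>Implies \<open>5 a < b^2 + 2 b + 6\<close>, that is
    \<open>3 b + 10 (q - i) < b^2 + 6\<close>, because \<open>b < m i + m\<close>.\<close>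
  define P where "P = (\<lambda>i::nat. m\<^sup>2 * (int i)\<^sup>2 \<ge> 10 * q + 3 * m * int i + 3 * m)"
  have mm: "m * m \<ge> 3 * m" using m by simp
  have q0: "q > 0" using q m by (smt (verit) zero_less_power)
  have "P (nat (10 * q + 4))"
  proof -
    define X Y where "X = 10 * q + 4" and "Y = m * X"
    have "Y \<ge> 3 * X" unfolding Y_def using m q0 by (intro mult_right_mono) (auto simp: X_def)
    moreover have "Y \<ge> m * 1" unfolding Y_def using m q0 by (intro mult_left_mono) (auto simp: X_def)
    moreover have "X \<ge> 10 * q" "X \<ge> 4" using q0 by (simp_all add: X_def)
    moreover from calculation have "Y * Y \<ge> 12 * Y" by (intro mult_right_mono) auto
    ultimately have "Y * Y \<ge> 10 * q + 3 * Y + 3 * m" by linarith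
    then have "m\<^sup>2 * X\<^sup>2 \<ge> 10 * q + 3 * m * X + 3 * m"
      by (simp add: Y_def power2_eq_square algebra_simps)
    then show ?thesis using \<open>X \<ge> 4\<close> by (simp add: P_def X_def)
  qed
  define i1 where "i1 = (LEAST j. P j)"
  have i1: "P i1" "\<And>j. P j \<Longrightarrow> i1 \<le> j"
    unfolding i1_def using LeastI[of P] Least_le[of P] \<open>P (nat (10 * q + 4))\<close> by blast+
  have "\<not> P 0" using q0 m by (simp add: P_def)
  then have "i1 \<noteq> 0" using i1(1) by metis
  define i0 j where "i0 = int i1" and "j = i0 - 1"
  have j0: "j \<ge> 0" using \<open>i1 \<noteq> 0\<close> by (simp add: i0_def j_def)
  have "\<not> P (i1 - 1)" using i1(2)[of "i1 - 1"] \<open>i1 \<noteq> 0\<close> by auto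
  then have jup: "m\<^sup>2 * j\<^sup>2 < 10 * q + 3 * m * j + 3 * m"
    using \<open>i1 \<noteq> 0\<close> by (simp add: P_def i0_def j_def of_nat_diff)
  \<comment> \<open>\<open>j = i0 - 1\<close> violates \<open>P\<close>, and
    \<open>b \<le> m (j + 7)\<close> on the window. If the claim failed, then
    \<open>j (j - 76) < 251\<close>, so \<open>j < 80\<close> and
    \<open>(j + 7)^2 \<le> 86^2 = 7396 < 12 * 924\<close>, a contradiction.\<close>
  have up: "m\<^sup>2 * (j + 7)\<^sup>2 \<le> 12 * q"
  proof (rule ccontr)
    assume "\<not> ?thesis"
    then have c: "12 * q < m\<^sup>2 * (j + 7)\<^sup>2" by simp
    have "m * 3 \<le> m\<^sup>2" using mm by (simp add: power2_eq_square)
    moreover have "m * 3 * j \<le> m\<^sup>2 * j" using calculation j0 by (intro mult_right_mono) auto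
    ultimately have "6 * (m\<^sup>2 * j\<^sup>2) < 5 * (m\<^sup>2 * (j + 7)\<^sup>2) + 6 * (m\<^sup>2 * j) + 6 * m\<^sup>2"
      using jup c by (simp add: algebra_simps)
    then have "m\<^sup>2 * (6 * j\<^sup>2) < m\<^sup>2 * (5 * (j + 7)\<^sup>2 + 6 * j + 6)"
      by (simp add: algebra_simps)
    then have "6 * j\<^sup>2 < 5 * (j + 7)\<^sup>2 + 6 * j + 6" using m by simp
    then have "j * (j - 76) < 251" by (simp add: power2_eq_square algebra_simps)
    moreover have "80 * 4 \<le> j * (j - 76)" if "j \<ge> 80" using that by (intro mult_mono) auto
    ultimately have "j < 80" by fastforce
    then have "(j + 7)\<^sup>2 \<le> 86\<^sup>2" using j0 by (intro power_mono) auto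
    then have "m\<^sup>2 * (j + 7)\<^sup>2 \<le> m\<^sup>2 * 7396" by (intro mult_left_mono) auto
    then show False using c q m by (smt (verit) zero_less_power)
  qed
  have "let b = r + m * i; a = b + 2 * (q - i)
     in a \<ge> 0 \<and> b \<ge> 0 \<and> b\<^sup>2 < 6 * a \<and> 5 * a < b\<^sup>2 + 2 * b + 6"
    if i: "i0 \<le> i" "i < i0 + 6" for i
  proof -
    define b a where "b = r + m * i" and "a = b + 2 * (q - i)"
    have ipos: "i \<ge> 1" using i j0 by (simp add: j_def)
    have mi: "m * i \<ge> 3 * i" using m ipos by (intro mult_right_mono) auto
    have b0: "b \<ge> 3 * i" using mi r by (simp add: b_def)
    have "b \<le> m * (i + 1)" using r by (simp add: b_def algebra_simps)
    also have "\<dots> \<le> m * (j + 7)" using i m by (intro mult_left_mono) (auto simp: j_def)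
    finally have "b\<^sup>2 \<le> (m * (j + 7))\<^sup>2" using b0 ipos by (intro power_mono) auto
    then have "b\<^sup>2 \<le> 12 * q" using up by (simp add: power_mult_distrib)
    then have 1: "b\<^sup>2 < 6 * a" using b0 ipos by (simp add: a_def)
    \<comment> \<open>The inequality in \<open>P\<close> passes from \<open>i0\<close> to larger
      \<open>i\<close>, since \<open>i (m i - 3)\<close> increases.\<close>
    have "m * (m * i0 * i0 - 3 * i0) \<le> m * (m * i * i - 3 * i)"
    proof (intro mult_left_mono)
      have "m * i0 \<ge> 3 * 1" using m j0 by (intro mult_mono) (auto simp: j_def)
      moreover have "m * i \<ge> m * i0" using m i by (intro mult_left_mono) auto
      ultimately have "i0 * (m * i0 - 3) \<le> i * (m * i - 3)"
        using i j0 by (intro mult_mono) (auto simp: j_def)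
      then show "m * i0 * i0 - 3 * i0 \<le> m * i * i - 3 * i" by (simp add: algebra_simps)
    qed (use m in auto)
    moreover have "m\<^sup>2 * i0\<^sup>2 \<ge> 10 * q + 3 * m * i0 + 3 * m" using i1(1) by (simp add: P_def i0_def)
    ultimately have "m\<^sup>2 * i\<^sup>2 \<ge> 10 * q + 3 * (m * i) + 3 * m"
      by (simp add: power2_eq_square algebra_simps)
    moreover have "b\<^sup>2 \<ge> (m * i)\<^sup>2" using b_def r m ipos by (intro power_mono) auto
    ultimately have "b\<^sup>2 \<ge> 10 * q + 3 * (m * i) + 3 * m" by (simp add: power_mult_distrib)
    then have "5 * a < b\<^sup>2 + 2 * b + 6" using r ipos by (simp add: a_def b_def algebra_simps)
    moreover have "a \<ge> 0" using 1 by (smt (verit) zero_le_power2)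
    ultimately show ?thesis using 1 b0 ipos unfolding a_def b_def Let_def by simp
  qed
  moreover have "i0 \<ge> 0" by (simp add: i0_def)
  ultimately show ?thesis by blast
qed

text \<open>A suitable class of \<open>i\<close> modulo 2 and one modulo 3 are found separately; six
  consecutive integers contain a common member.\<close>

lemma good_residue_mod_6:
  fixes m q r i0 :: int
  shows "\<exists>i. i0 \<le> i \<and> i < i0 + 6 \<and>
    (let b = r + m * i; a = b + 2 * (q - i)
     in (odd b \<or> even b \<and> odd (a div 2 + b div 2)) \<and> (\<not> 3 dvd b \<or> 3 dvd b \<and> a mod 3 = 2))"
proof -
  have "\<exists>c2\<in>{0,1}. \<forall>i. i mod 2 = c2 \<longrightarrow>
     (odd (r + m * i) \<or> even (r + m*i) \<and> odd ((r + m * i + 2 * (q - i)) div 2 + (r + m * i) div 2))"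
  proof (cases "even m \<and> even r")
    case False
    have odd: "odd (r + m * i)" if "i mod 2 = (r + 1) mod 2" for i
    proof -
      have "even i \<longleftrightarrow> odd r" using that by presburger
      then show ?thesis using False unfolding even_add even_mult_iff by blast
    qed
    show ?thesis
    proof (rule bexI)
      show "(r + 1) mod 2 \<in> {0, 1}" unfolding insert_iff empty_iff by presburger
    qed (rule allI, rule impI, rule disjI1, rule odd)
  next
    case True
    \<comment> \<open>With \<open>m\<close> and \<open>r\<close> even,
      \<open>a div 2 + b div 2 = b + q - i\<close>, so the parity of \<open>i\<close>
      decides.\<close>
    have odd: "even (r + m * i) \<and> odd ((r + m * i + 2 * (q - i)) div 2 + (r + m * i) div 2)"
      if "i mod 2 = (q + 1) mod 2" for i
    proof -
      have ev: "even (r + m * i)" using True by simp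
      then obtain h where h: "r + m * i = 2 * h" by (rule evenE)
      have "(r + m * i + 2 * (q - i)) div 2 + (r + m * i) div 2 = 2 * h + (q - i)"
        unfolding h by simp
      moreover have "odd (q - i)" using that by presburger
      ultimately show ?thesis using ev by simp
    qed
    show ?thesis
    proof (rule bexI)
      show "(q + 1) mod 2 \<in> {0, 1}" unfolding insert_iff empty_iff by presburger
    qed (rule allI, rule impI, rule disjI2, rule odd)
  qed
  then obtain c2 where c2: "c2 \<in> {0, 1}" "\<And>i. i mod 2 = c2 \<Longrightarrow>
     (odd (r + m * i) \<or> even (r + m*i) \<and> odd ((r + m * i + 2 * (q - i)) div 2 + (r + m * i) div 2))"
    by blast
  have "\<exists>c3\<in>{0,1,2}. \<forall>i. i mod 3 = c3 \<longrightarrow>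
     (\<not> 3 dvd r + m * i \<or> 3 dvd r + m * i \<and> (r + m * i + 2 * (q - i)) mod 3 = 2)"
  proof (cases "3 dvd m")
    case True
    show ?thesis
    proof (cases "3 dvd r")
      case False
      then have "\<not> 3 dvd r + m * i" for i using True by (simp add: dvd_add_left_iff)
      then show ?thesis by blast
    next
      case r: True
      have res: "3 dvd r + m * i \<and> (r + m * i + 2 * (q - i)) mod 3 = 2" if "i mod 3 = (q - 1) mod 3" for i
      proof -
        have "3 dvd r + m * i" using True r by simp
        moreover have "(2 * (q - i)) mod 3 = 2" using that by presburger
        ultimately show ?thesis by presburger
      qed
      show ?thesis
      proof (rule bexI)
        show "(q - 1) mod 3 \<in> {0,1,2}" unfolding insert_iff empty_iff by presburger
      qed (rule allI, rule impI, rule disjI2, rule res)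
    qed
  next
    case False
    \<comment> \<open>As \<open>m^2\<close> is 1 modulo 3, this solves \<open>r + m i = 1\<close>
      modulo 3.\<close>
    define c where "c = (m * (1 - r)) mod 3"
    have "\<not> 3 dvd r + m * i" if "i mod 3 = c" for i
    proof -
      have "3 dvd i - m * (1 - r)" using that unfolding c_def by (simp add: mod_eq_dvd_iff)
      then have "3 dvd m * (i - m * (1 - r))" by simp
      moreover have "3 dvd m * m - 1"
      proof -
        have "m mod 3 = 1 \<or> m mod 3 = 2" using False by presburger
        then have "(m mod 3) * (m mod 3) mod 3 = 1" by auto
        then show ?thesis by (simp add: mod_mult_eq mod_eq_dvd_iff[symmetric])
      qed
      then have "3 dvd (m * m - 1) * (1 - r)" by simp
      ultimately have "3 dvd m * (i - m * (1 - r)) + (m * m - 1) * (1 - r)" by (rule dvd_add)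
      then have "3 dvd r + m * i - 1" by (simp add: algebra_simps)
      then show ?thesis by presburger
    qed
    moreover have "c \<in> {0,1,2}" unfolding c_def by auto
    ultimately show ?thesis by blast
  qed
  then obtain c3 where c3: "c3 \<in> {0,1,2}" "\<And>i. i mod 3 = c3 \<Longrightarrow>
     (\<not> 3 dvd r + m * i \<or> 3 dvd r + m * i \<and> (r + m * i + 2 * (q - i)) mod 3 = 2)"
    by blast
  \<comment> \<open>Chinese remainders: 3 is 1 modulo 2 and 0 modulo 3, while 4 is 0 modulo 2 and 1
    modulo 3.\<close>
  define c where "c = 3 * c2 + 4 * c3"
  have "c2 = 0 \<or> c2 = 1" "c3 = 0 \<or> c3 = 1 \<or> c3 = 2" using c2(1) c3(1) by simp_all
  then have c: "c mod 2 = c2" "c mod 3 = c3" unfolding c_def by presburger+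
  define i where "i = i0 + (c - i0) mod 6"
  have "i mod 6 = c mod 6" by (simp add: i_def mod_add_right_eq)
  then have "i mod 6 mod 2 = c mod 6 mod 2" "i mod 6 mod 3 = c mod 6 mod 3" by simp_all
  then have im: "i mod 2 = c2" "i mod 3 = c3" by (simp_all add: mod_mod_cancel c)
  have "0 \<le> (c - i0) mod 6" "(c - i0) mod 6 < 6" by simp_all
  then have "i0 \<le> i" "i < i0 + 6" unfolding i_def by linarith+
  show ?thesis unfolding Let_def
    by (rule exI[of _ i], intro conjI; fact \<open>i0 \<le> i\<close> \<open>i < i0 + 6\<close> c2(2)[OF im(1)] c3(2)[OF im(2)])
qed

section \<open>Representation by the form and the main theorem\<close>

text \<open>A square root of \<open>- lam * k\<close> modulo \<open>p\<close>, divided by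
  \<open>lam\<close>, is the desired \<open>x\<close>.\<close>

lemma quadratic_root_mod_prime:
  fixes lam k :: int
  assumes p: "prime p" "p > 2" and L: "Legendre (- (lam * k)) (int p) = 1" and lam: "\<not> int p dvd lam"
  shows "\<exists>x. int p dvd lam * x\<^sup>2 + k"
proof -
  obtain y where y: "int p dvd y\<^sup>2 + lam * k" using Legendre_eq_1D[OF L] by auto
  have "coprime lam (int p)" using lam p(1) prime_imp_coprime[of "int p" lam] by (simp add: coprime_commute)
  then obtain c where "[lam * c = 1] (mod int p)" using cong_solve_coprime_int by blast
  then have c: "int p dvd lam * c - 1" by (simp add: cong_iff_dvd_diff)
  have "lam * (lam * (c * y)\<^sup>2 + k) = (lam * c - 1) * (lam * c + 1) * y\<^sup>2 + (y\<^sup>2 + lam * k)"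
    by (simp add: power2_eq_square algebra_simps)
  also have "int p dvd \<dots>" using c y by simp
  finally have "int p dvd lam * (lam * (c * y)\<^sup>2 + k)" .
  then have "int p dvd lam * (c * y)\<^sup>2 + k"
    using lam p(1) prime_dvd_mult_iff[of "int p"] by auto
  then show ?thesis by blast
qed

lemma coprime_of_Legendre:
  fixes k n :: nat
  assumes "\<And>p. prime p \<Longrightarrow> p dvd n \<Longrightarrow> Legendre (int k) (int p) \<noteq> 0"
  shows "coprime (int k) (int n)"
proof -
  have "coprime k n"
  proof (rule ccontr)
    assume "\<not> coprime k n"
    then have "gcd k n \<noteq> 1" by (simp only: coprime_iff_gcd_eq_1 not_False_eq_True)
    then obtain p where "prime p" "p dvd gcd k n" using prime_factor_nat by blast
    then show False using assms[of p] by (simp add: Legendre_zero_iff)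
  qed
  then show ?thesis by simp
qed

lemma chi4_prod_Legendre:
  assumes "odd n" "squarefree n"
  shows "(\<Prod>p\<in>prime_factors n. Legendre (-1) (int p)) = chi4 n"
proof -
  have "(\<Prod>p\<in>A. chi4 p) = chi4 (\<Prod>A)" if "finite A" for A
    using that by (induction rule: finite_induct) (simp_all add: chi4_mult, simp add: chi4_def)
  then have "(\<Prod>p\<in>prime_factors n. chi4 p) = chi4 n"
    using squarefree_prod_prime_factors[OF assms(2)] by simp
  moreover have "Legendre (-1) (int p) = chi4 p" if "p \<in> prime_factors n" for p
  proof (rule Legendre_minus_1)
    show "prime p" using that by blast
    have "odd p" using that assms(1) by (auto intro: dvd_trans)
    then show "p > 2" using prime_ge_2_nat[OF \<open>prime p\<close>] by (cases "p = 2") auto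
  qed
  ultimately show ?thesis by (simp cong: prod.cong)
qed

text \<open>Here \<open>lam = 1\<close> and \<open>D = 3 n\<close>. Prescribing
  \<open>(k/3) = 1\<close> and \<open>(k/p) = (-1/p)\<close> makes \<open>- k\<close> a square
  modulo \<open>n\<close>. If \<open>D\<close> is 3 modulo 4, then \<open>n\<close> is 1 modulo 4
  and the prescribed signs multiply to \<open>chi4 n = 1\<close>.\<close>

lemma represented_squarefree_2_mod_3:
  fixes n :: nat
  assumes n: "odd n" "squarefree n" "n mod 3 = 2"
  shows "\<exists>x y z. int n = x\<^sup>2 + y\<^sup>2 + 3 * z\<^sup>2"
proof -
  have n0: "n > 0" using n(1) by (rule odd_pos)
  have n3: "\<not> 3 dvd n" using n(3) by presburger
  have p3: "prime (3::nat)" by simp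
  have cop3: "coprime 3 n" using n3 p3 by (simp add: prime_imp_coprime)
  define D where "D = 3 * n"
  have "odd D" using n(1) by (simp add: D_def)
  moreover have "squarefree D"
    unfolding D_def by (rule squarefree_mult_coprime[OF cop3 squarefree_prime[OF p3] n(2)])
  ultimately have D: "odd D" "squarefree D" by auto
  have pfD: "prime_factors D = insert 3 (prime_factors n)"
    using n0 p3 by (simp add: D_def prime_factors_product prime_factorization_prime)
  have not3: "3 \<notin> prime_factors n" using n3 by auto
  define \<epsilon> where "\<epsilon> = (\<lambda>p::nat. if p = 3 then 1 else Legendre (-1) (int p))"
  have eps: "\<epsilon> p \<in> {-1, 1}" if "p \<in> prime_factors D" for p
  proof -
    have "p > 1" using that prime_gt_1_nat[of p] by blast
    then have "\<not> int p dvd 1" by simp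
    then show ?thesis
      using Legendre_vals[of "-1" "int p"] Legendre_zero_iff[of "-1" "int p"] by (auto simp: \<epsilon>_def)
  qed
  have prod_eps: "(\<Prod>p\<in>prime_factors D. \<epsilon> p) = 1" if "D mod 4 = 3"
  proof -
    have "(\<Prod>p\<in>prime_factors D. \<epsilon> p) = (\<Prod>p\<in>prime_factors n. \<epsilon> p)"
      unfolding pfD using not3 by (simp add: \<epsilon>_def)
    also have "\<dots> = (\<Prod>p\<in>prime_factors n. Legendre (-1) (int p))"
      using not3 by (intro prod.cong) (auto simp: \<epsilon>_def)
    also have "\<dots> = chi4 n" by (rule chi4_prod_Legendre[OF n(1,2)])
    also have "\<dots> = 1"
    proof -
      have "n mod 4 = 1" using that unfolding D_def by presburger
      then show ?thesis by (simp add: chi4_def)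
    qed
    finally show ?thesis .
  qed
  obtain k x where k: "k > 0" "\<And>p. p \<in> prime_factors D \<Longrightarrow> Legendre (int k) (int p) = \<epsilon> p"
      "int k dvd x\<^sup>2 + int D"
    using exists_square_modulus[of D \<epsilon>, OF D eps prod_eps] by blast
  have "Legendre (int k) 3 = 1" using k(2)[of 3] pfD by (simp add: \<epsilon>_def)
  then have k3: "int k mod 3 = 1" by (auto simp: Legendre_3 split: if_splits)
  obtain l where l: "x\<^sup>2 + int D = int k * l" using k(3) by blast
  have nonzero: "Legendre (int k) (int p) \<noteq> 0" if "prime p" "p dvd n" for p
    using that n0 k(2)[of p] eps[of p] pfD by (auto simp: in_prime_factors_iff)
  have "\<exists>e. int n dvd 1 * e\<^sup>2 + int k"
  proof (rule squarefree_dvd_quadratic[OF n(2)])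
    fix p assume p: "prime p" "p dvd n"
    have "odd p" using p n(1) by (auto intro: dvd_trans)
    then have p2: "p > 2" using prime_ge_2_nat[OF p(1)] by (cases "p = 2") auto
    have pf: "p \<in> prime_factors n" using p n0 by (auto simp: in_prime_factors_iff)
    then have "Legendre (int k) (int p) = Legendre (-1) (int p)"
      using k(2)[of p] not3 pfD by (auto simp: \<epsilon>_def)
    then have "Legendre (-1 * int k) (int p) = Legendre (-1) (int p) * Legendre (-1) (int p)"
      by (simp only: Legendre_mult[OF p(1) p2])
    also have "\<dots> = 1"
    proof -
      have "p \<noteq> 3" using pf not3 by blast
      then have "\<epsilon> p = Legendre (-1) (int p)" by (simp add: \<epsilon>_def)
      then show ?thesis using eps[of p] pf pfD by auto
    qed
    finally show "\<exists>e. int p dvd 1 * e\<^sup>2 + int k"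
      using Legendre_eq_1D[of "- int k" "int p"] by simp
  qed
  then obtain e where e: "int n dvd 1 * e\<^sup>2 + int k" by blast
  have "\<exists>x y z. 1 * int n = x\<^sup>2 + y\<^sup>2 + 3 * z\<^sup>2"
  proof (rule represented_by_1_1_3[OF _ _ _ _ _ e])
    show "int k * l - x\<^sup>2 = int D" using l by simp
    show "1 * int D = 3 * int n" by (simp add: D_def)
    show "coprime (int k) (int n)" by (rule coprime_of_Legendre[OF nonzero])
    have "\<not> 3 dvd int n" using n3 by presburger
    then show "1 = (1::int) \<and> int k mod 3 = 1 \<and> \<not> 3 dvd int n \<or> 1 = (3::int) \<and> int n mod 3 = 1"
      using k3 by simp
  qed (use n0 k(1) in auto)
  then show ?thesis by simp
qed

text \<open>Here \<open>lam = 3\<close> and \<open>D = n\<close>. Prescribing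
  \<open>(k/p) = (-3/p)\<close> makes \<open>-3 k\<close> a square modulo \<open>n\<close>. By
  reciprocity \<open>(-3/p) = (p/3)\<close>, so the prescribed signs multiply to
  \<open>(n/3) = 1\<close>.\<close>

lemma represented_squarefree_1_mod_3:
  fixes n :: nat
  assumes n: "odd n" "squarefree n" "n mod 3 = 1"
  shows "\<exists>x y z. 3 * int n = x\<^sup>2 + y\<^sup>2 + 3 * z\<^sup>2"
proof -
  have n0: "n > 0" using n(1) by (rule odd_pos)
  have pf: "prime p" "p > 2" "\<not> p dvd 3" "p \<noteq> 3" if "p \<in> prime_factors n" for p
  proof -
    have p: "prime p" "p dvd n" using that by auto
    show "prime p" by fact
    have "odd p" using p n(1) by (auto intro: dvd_trans)
    then show "p > 2" using prime_ge_2_nat[OF p(1)] by (cases "p = 2") auto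
    have "\<not> 3 dvd n" using n(3) by presburger
    then show "p \<noteq> 3" using p by auto
    then show "\<not> p dvd 3" using primes_dvd_imp_eq[of p 3] p(1) by auto
  qed
  have p3: "prime (3::nat)" by simp
  define \<epsilon> where "\<epsilon> = (\<lambda>p::nat. Legendre (-3) (int p))"
  have eps_eq: "\<epsilon> p = Legendre (int p) 3" if "p \<in> prime_factors n" for p
  proof -
    have "Legendre (- int 3) (int p) = (if (3::nat) mod 4 = 1 then chi4 p else 1)
        * (\<Prod>q\<in>prime_factors 3. Legendre (int p) (int q))"
      using pf[OF that] p3 by (intro Legendre_minus_squarefree squarefree_prime) auto
    moreover have "prime_factors (3::nat) = {3}" using p3 by (simp add: prime_factorization_prime)
    ultimately show ?thesis by (simp add: \<epsilon>_def)
  qed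
  have eps: "\<epsilon> p \<in> {-1, 1}" if "p \<in> prime_factors n" for p
  proof -
    have "\<not> int p dvd - int 3" using pf(3)[OF that] by (metis dvd_minus_iff int_dvd_int_iff)
    then show ?thesis
      using Legendre_vals[of "-3" "int p"] Legendre_zero_iff[of "-3" "int p"] by (auto simp: \<epsilon>_def)
  qed
  have prod_eps: "(\<Prod>p\<in>prime_factors n. \<epsilon> p) = 1"
  proof -
    have "(\<Prod>p\<in>prime_factors n. \<epsilon> p) = (\<Prod>p\<in>prime_factors n. Legendre (int p) (int 3))"
      using eps_eq by (intro prod.cong) auto
    also have "\<dots> = Legendre (\<Prod>p\<in>prime_factors n. int p) (int 3)"
      using p3 by (intro Legendre_prod[symmetric]) auto
    also have "(\<Prod>p\<in>prime_factors n. int p) = int n"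
      using squarefree_prod_prime_factors[OF n(2)] of_nat_prod[of "\<lambda>p. p" "prime_factors n", where ?'a = int]
      by simp
    also have "Legendre (int n) (int 3) = 1"
    proof -
      have "int n mod 3 = 1" using n(3) by presburger
      then show ?thesis by (simp add: Legendre_3)
    qed
    finally show ?thesis .
  qed
  obtain k x where k: "k > 0" "\<And>p. p \<in> prime_factors n \<Longrightarrow> Legendre (int k) (int p) = \<epsilon> p"
      "int k dvd x\<^sup>2 + int n"
    using exists_square_modulus[of n \<epsilon>, OF n(1,2) eps prod_eps] by blast
  obtain l where l: "x\<^sup>2 + int n = int k * l" using k(3) by blast
  have nonzero: "Legendre (int k) (int p) \<noteq> 0" if "prime p" "p dvd n" for p
    using that n0 k(2)[of p] eps[of p] by (auto simp: in_prime_factors_iff)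
  have "\<exists>e. int n dvd 3 * e\<^sup>2 + int k"
  proof (rule squarefree_dvd_quadratic[OF n(2)])
    fix p assume "prime p" "p dvd n"
    then have p: "p \<in> prime_factors n" using n0 by (auto simp: in_prime_factors_iff)
    have "Legendre (-3 * int k) (int p) = \<epsilon> p * \<epsilon> p"
      using k(2)[OF p] by (simp only: Legendre_mult[OF pf(1,2)[OF p]] \<epsilon>_def)
    also have "\<dots> = 1" using eps[OF p] by auto
    finally have "Legendre (- (3 * int k)) (int p) = 1" by simp
    moreover have "\<not> int p dvd int 3" using pf(3)[OF p] by (simp only: int_dvd_int_iff not_False_eq_True)
    ultimately show "\<exists>e. int p dvd 3 * e\<^sup>2 + int k"
      using quadratic_root_mod_prime[OF pf(1,2)[OF p], of 3 "int k"] by simp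
  qed
  then obtain e where e: "int n dvd 3 * e\<^sup>2 + int k" by blast
  show ?thesis
  proof (rule represented_by_1_1_3[OF _ _ _ _ _ e])
    show "int k * l - x\<^sup>2 = int n" using l by simp
    show "coprime (int k) (int n)" by (rule coprime_of_Legendre[OF nonzero])
    have "int n mod 3 = 1" using n(3) by presburger
    then show "3 = (1::int) \<and> int k mod 3 = 1 \<and> \<not> 3 dvd int n \<or> 3 = (3::int) \<and> int n mod 3 = 1"
      by simp
  qed (use n0 k(1) in auto)
qed

section \<open>Passage to odd numbers with square factors\<close>

lemma square_mod_3_nat:
  fixes t :: nat
  assumes "\<not> 3 dvd t"
  shows "t\<^sup>2 mod 3 = 1"
proof -
  have "t mod 3 = 1 \<or> t mod 3 = 2" using assms by presburger
  moreover have "t\<^sup>2 mod 3 = ((t mod 3)\<^sup>2) mod 3" by (simp add: power_mod)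
  ultimately show ?thesis by (elim disjE) simp_all
qed

text \<open>A square factor prime to 3 preserves the residue modulo 3 and scales a representation.
  In the second case \<open>n = 3 m\<close> with \<open>m\<close> 1 modulo 3.\<close>

lemma represented_odd:
  fixes n :: int
  assumes n: "n > 0" "odd n" "n mod 3 = 2 \<or> n mod 9 = 3"
  shows "\<exists>x y z. n = x\<^sup>2 + y\<^sup>2 + 3 * z\<^sup>2"
proof -
  have scale: "\<exists>x y z. a * t\<^sup>2 = x\<^sup>2 + y\<^sup>2 + 3 * z\<^sup>2" if rep: "\<exists>x y z. a = x\<^sup>2 + y\<^sup>2 + 3 * z\<^sup>2" for a t :: int
  proof -
    obtain x y z where "a = x\<^sup>2 + y\<^sup>2 + 3 * z\<^sup>2" using rep by blast
    then have "a * t\<^sup>2 = (x * t)\<^sup>2 + (y * t)\<^sup>2 + 3 * (z * t)\<^sup>2" by (simp add: algebra_simps power_mult_distrib)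
    then show ?thesis by blast
  qed
  have decomp: "\<exists>s t. m = s * t\<^sup>2 \<and> squarefree s \<and> odd s \<and> s mod 3 = m mod 3"
    if m: "odd m" "\<not> 3 dvd m" for m :: nat
  proof -
    define s t :: nat where "s = squarefree_part m" and "t = square_part m"
    have mst: "m = s * t\<^sup>2" unfolding s_def t_def by (rule squarefree_decompose)
    have "\<not> 3 dvd t" using m(2) mst by (auto simp: power2_eq_square)
    then have "t\<^sup>2 mod 3 = 1" by (rule square_mod_3_nat)
    then have "m mod 3 = s mod 3" unfolding mst by (metis mod_mult_right_eq mult.right_neutral)
    moreover have "odd s" using m(1) mst by auto
    moreover have "squarefree s" by (simp add: s_def)
    ultimately show ?thesis using mst by metis
  qed
  from n(3) show ?thesis
  proof
    assume 2: "n mod 3 = 2"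
    define m where "m = nat n"
    have m: "n = int m" using n(1) by (simp add: m_def)
    have "odd m" "\<not> 3 dvd m" "m mod 3 = 2" using n(2) 2 unfolding m by presburger+
    then obtain s t where "m = s * t\<^sup>2" "squarefree s" "odd s" "s mod 3 = 2" using decomp by metis
    then show ?thesis using scale[OF represented_squarefree_2_mod_3[of s], of "int t"] m by simp
  next
    assume 3: "n mod 9 = 3"
    define m where "m = nat (n div 3)"
    have "n = 3 * (n div 3)" "n div 3 > 0" using 3 n(1) by presburger+
    then have m: "n = 3 * int m" by (simp add: m_def)
    have "odd m" "\<not> 3 dvd m" "m mod 3 = 1" using n(2) 3 unfolding m by presburger+
    then obtain s t where st: "m = s * t\<^sup>2" "squarefree s" "odd s" "s mod 3 = 1" using decomp by metis
    have "\<exists>x y z. 3 * int s * (int t)\<^sup>2 = x\<^sup>2 + y\<^sup>2 + 3 * z\<^sup>2"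
      by (rule scale[OF represented_squarefree_1_mod_3]) (use st in auto)
    then show ?thesis using m st(1) by (simp add: mult.assoc)
  qed
qed

section \<open>Parities and signs in the representation\<close>

lemma square_mod_4_int:
  fixes x :: int
  shows "x\<^sup>2 mod 4 = (if even x then 0 else 1)"
proof (cases "even x")
  case True
  then obtain c where "x = 2 * c" by (rule evenE)
  then show ?thesis by (simp add: power_mult_distrib)
next
  case False
  then obtain c where "x = 2 * c + 1" by (rule oddE)
  then have "x\<^sup>2 = 4 * (c\<^sup>2 + c) + 1" by (simp add: power2_eq_square algebra_simps)
  then show ?thesis using False by presburger
qed

text \<open>For odd \<open>b\<close> the number is 1 modulo 4, which forces one of \<open>x\<close>,
  \<open>y\<close> to be odd and the other to share the parity of \<open>z\<close>. For even
  \<open>b\<close> it is 4 times an odd number, and a representation of the quotient is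
  doubled.\<close>

lemma parity_adjusted_representation:
  fixes a b :: int
  assumes ab: "even (a - b)" "6 * a - b\<^sup>2 > 0"
    and par: "odd b \<or> even b \<and> odd (a div 2 + b div 2)"
    and mod3: "\<not> 3 dvd b \<or> 3 dvd b \<and> a mod 3 = 2"
  shows "\<exists>t s v. 6 * a - b\<^sup>2 = t\<^sup>2 + s\<^sup>2 + 3 * v\<^sup>2 \<and> even (t + b) \<and> even (s + v)"
proof -
  define n where "n = 6 * a - b\<^sup>2"
  have n3: "n mod 3 = 2 \<or> n mod 9 = 3"
  proof (cases "3 dvd b")
    case True
    then obtain c where c: "b = 3 * c" by blast
    have "a mod 3 = 2" using mod3 True by blast
    then obtain d where d: "a = 3 * d + 2" by (metis mult_div_mod_eq)
    have "n = 9 * (2 * d - c\<^sup>2 + 1) + 3" by (simp add: n_def c d power_mult_distrib)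
    then show ?thesis by presburger
  next
    case False
    have "3 dvd b\<^sup>2 - 1"
    proof -
      have "b\<^sup>2 - 1 = (b - 1) * (b + 1)" by (simp add: power2_eq_square algebra_simps)
      moreover have "3 dvd b - 1 \<or> 3 dvd b + 1" using False by presburger
      ultimately show ?thesis by auto
    qed
    then have "n mod 3 = 2" unfolding n_def by presburger
    then show ?thesis ..
  qed
  show ?thesis
  proof (cases "even b")
    case False
    then have "odd n" by (simp add: n_def)
    then obtain x y z where xyz: "n = x\<^sup>2 + y\<^sup>2 + 3 * z\<^sup>2"
      using represented_odd[of n] n3 ab(2) by (auto simp: n_def)
    have "b\<^sup>2 mod 4 = 1" using square_mod_4_int[of b] False by simp
    moreover have "odd a" using ab(1) False by presburger
    ultimately have "n mod 4 = 1" unfolding n_def by presburger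
    moreover have "(X + Y + 3 * Z) mod 4 = (X mod 4 + Y mod 4 + 3 * (Z mod 4)) mod 4" for X Y Z :: int
      by presburger
    ultimately have "(x\<^sup>2 mod 4 + y\<^sup>2 mod 4 + 3 * (z\<^sup>2 mod 4)) mod 4 = 1" using xyz by metis
    then have "even (x + b) \<and> even (y + z) \<or> even (y + b) \<and> even (x + z)"
      using False by (simp add: square_mod_4_int split: if_splits)
    moreover have "n = y\<^sup>2 + x\<^sup>2 + 3 * z\<^sup>2" using xyz by simp
    ultimately show ?thesis using xyz unfolding n_def by blast
  next
    case True
    then obtain c where c: "b = 2 * c" by (rule evenE)
    have "even a" using ab(1) True by presburger
    then obtain d where d: "a = 2 * d" by (rule evenE)
    define m where "m = 3 * d - c\<^sup>2"
    have nm: "n = 4 * m" by (simp add: n_def m_def c d power_mult_distrib)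
    have "odd (d + c)" using par True c d by simp
    then have "odd m" by (simp add: m_def)
    moreover have "m > 0" using ab(2) nm by (simp add: n_def)
    moreover have "m mod 3 = 2 \<or> m mod 9 = 3" using n3
    proof
      assume "n mod 3 = 2"
      then show ?thesis unfolding nm by presburger
    next
      assume "n mod 9 = 3"
      then obtain u where "n = 9 * u + 3" by (metis mult_div_mod_eq)
      \<comment> \<open>7 inverts 4 modulo 9.\<close>
      then have "m = 3 + 9 * (7 * u + 2 - 3 * m)" using nm by presburger
      then obtain w where "m = 3 + 9 * w" by blast
      then show ?thesis by simp
    qed
    ultimately obtain x y z where "m = x\<^sup>2 + y\<^sup>2 + 3 * z\<^sup>2" using represented_odd by blast
    then have "n = (2 * x)\<^sup>2 + (2 * y)\<^sup>2 + 3 * (2 * z)\<^sup>2" by (simp add: nm power_mult_distrib)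
    then show ?thesis using True unfolding n_def by (intro exI[of _ "2 * x"] exI[of _ "2 * y"] exI[of _ "2 * z"]) simp
  qed
qed

lemma sign_choice_mod_3:
  fixes t b :: int
  assumes "3 dvd t \<longleftrightarrow> 3 dvd b"
  shows "\<exists>t'. t'\<^sup>2 = t\<^sup>2 \<and> (even t' \<longleftrightarrow> even t) \<and> 3 dvd t' + b"
proof -
  have "3 dvd t + b \<or> 3 dvd - t + b" using assms by presburger
  then show ?thesis
  proof
    assume "3 dvd t + b"
    then show ?thesis by (intro exI[of _ t]) simp
  next
    assume "3 dvd - t + b"
    then show ?thesis by (intro exI[of _ "- t"]) simp
  qed
qed

text \<open>Modulo 3 the hypothesis reads \<open>t^2 + s^2 + b^2 = 0\<close>; squares being 0 or 1,
  all three vanish or none does.\<close>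

lemma square_sum_mod_3:
  fixes a b t s v :: int
  assumes "6 * a - b\<^sup>2 = t\<^sup>2 + s\<^sup>2 + 3 * v\<^sup>2"
  shows "(3 dvd t \<longleftrightarrow> 3 dvd b) \<and> (3 dvd s \<longleftrightarrow> 3 dvd b)"
proof -
  have sq: "3 dvd z \<and> z\<^sup>2 mod 3 = 0 \<or> \<not> 3 dvd z \<and> z\<^sup>2 mod 3 = 1" for z :: int
  proof (cases "3 dvd z")
    case True
    then show ?thesis by (auto simp: power2_eq_square)
  next
    case False
    then have "3 dvd z - 1 \<or> 3 dvd z + 1" by presburger
    moreover have "z\<^sup>2 - 1 = (z - 1) * (z + 1)" by (simp add: power2_eq_square algebra_simps)
    ultimately have "3 dvd z\<^sup>2 - 1" by auto
    then show ?thesis using False by presburger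
  qed
  define B T S V where "B = b\<^sup>2" and "T = t\<^sup>2" and "S = s\<^sup>2" and "V = v\<^sup>2"
  have "6 * a - B = T + S + 3 * V" using assms by (simp add: B_def T_def S_def V_def)
  then have "(T mod 3 + S mod 3 + B mod 3) mod 3 = 0" by presburger
  then show ?thesis using sq[of b] sq[of t] sq[of s] unfolding B_def T_def S_def by auto
qed

section \<open>Assembly of the representation\<close>

theorem theorem1p3:
  fixes m N :: int
  assumes "m \<ge> 3" and "N \<ge> 924 * m ^ 3"
  shows "\<exists>x1 x2 x3 x4 :: nat.
    N = polygonal (m + 2) (int x1) + polygonal (m + 2) (int x2) + polygonal (m + 2) (int x3)
        + 3 * polygonal (m + 2) (int x4)"
proof -
  define q r where "q = N div m" and "r = N mod m"
  have N: "N = m * q + r" by (simp add: q_def r_def)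
  have r: "0 \<le> r" "r < m" using assms(1) by (simp_all add: r_def)
  have "924 * m ^ 3 div m \<le> N div m" using assms by (intro zdiv_mono1) auto
  moreover have "924 * m ^ 3 = (924 * m\<^sup>2) * m" by (simp add: power2_eq_square power3_eq_cube)
  ultimately have q: "q \<ge> 924 * m\<^sup>2" using assms(1) by (simp add: q_def)
  obtain i0 where i0: "\<And>i. i0 \<le> i \<and> i < i0 + 6 \<Longrightarrow>
      (let b = r + m * i; a = b + 2 * (q - i)
       in a \<ge> 0 \<and> b \<ge> 0 \<and> b\<^sup>2 < 6 * a \<and> 5 * a < b\<^sup>2 + 2 * b + 6)"
    using window_exists[OF assms(1) q r] by blast
  obtain i where i: "i0 \<le> i \<and> i < i0 + 6" and good:
    "let b = r + m * i; a = b + 2 * (q - i)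
     in (odd b \<or> even b \<and> odd (a div 2 + b div 2)) \<and> (\<not> 3 dvd b \<or> 3 dvd b \<and> a mod 3 = 2)"
    using good_residue_mod_6[of i0 r m q] by blast
  define b where "b = r + m * i"
  define a where "a = b + 2 * (q - i)"
  have bnd: "a \<ge> 0" "b \<ge> 0" "b\<^sup>2 < 6 * a" "5 * a < b\<^sup>2 + 2 * b + 6"
    using i0[OF i] unfolding Let_def a_def b_def by simp_all
  have good': "odd b \<or> even b \<and> odd (a div 2 + b div 2)" "\<not> 3 dvd b \<or> 3 dvd b \<and> a mod 3 = 2"
    using good unfolding Let_def a_def b_def by blast+
  have "even (a - b)" "6 * a - b\<^sup>2 > 0" using bnd by (simp_all add: a_def)
  then obtain t s v where tsv: "6 * a - b\<^sup>2 = t\<^sup>2 + s\<^sup>2 + 3 * v\<^sup>2" "even (t + b)" "even (s + v)"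
    using parity_adjusted_representation good' by blast
  \<comment> \<open>Sign changes of \<open>t\<close> and \<open>s\<close> keep squares and parities
    and achieve the divisibility by 3.\<close>
  obtain t' where t': "t'\<^sup>2 = t\<^sup>2" "even t' \<longleftrightarrow> even t" "3 dvd t' + b"
    using sign_choice_mod_3 square_sum_mod_3[OF tsv(1)] by blast
  obtain s' where s': "s'\<^sup>2 = s\<^sup>2" "even s' \<longleftrightarrow> even s" "3 dvd s' + b"
    using sign_choice_mod_3 square_sum_mod_3[OF tsv(1)] by blast
  obtain x y z w :: nat where xyzw: "a = (int x)\<^sup>2 + (int y)\<^sup>2 + (int z)\<^sup>2 + 3 * (int w)\<^sup>2"
      "b = int x + int y + int z + 3 * int w"
    using cauchy_lemma_1_1_1_3[of b a t' s' v] bnd tsv t' s' by auto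
  \<comment> \<open>With \<open>a = b + 2 (q - i)\<close> and \<open>b = r + m i\<close>, the
    right-hand side is \<open>2 b + 2 m (q - i) = 2 (m q + r)\<close>.\<close>
  have "2 * (polygonal (m + 2) (int x) + polygonal (m + 2) (int y) + polygonal (m + 2) (int z)
        + 3 * polygonal (m + 2) (int w)) = m * a - (m - 2) * b"
    unfolding xyzw distrib_left mult.left_commute[of 2 3] two_times_polygonal
    by (simp add: algebra_simps)
  also have "\<dots> = 2 * N" unfolding N a_def b_def by (simp add: algebra_simps)
  finally show ?thesis by (intro exI[of _ x] exI[of _ y] exI[of _ z] exI[of _ w]) simp
qed

end
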